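(* Let $\nu,N\in\mathcal N$ and suppose that $P^{(a)}_m(\nu,N)\ge 0$ for every $(a,m)\in H'(N)$. Then the number of off-diagonal solutions $(z^{(a)}_{m\alpha})$ of the string center equation of pattern $N$ (for the quantum space datum $\nu$), divided by $\prod_{(a,m)\in H'(N)}N^{(a)}_m!$, is equal to $R(\nu,N)$.
   Context: Lie data. Fix an affine type $X^{(r)}_N$ among $A^{(1)}_n\,(n\ge1)$, $B^{(1)}_n\,(n\ge3)$, $C^{(1)}_n\,(n\ge2)$, $D^{(1)}_n\,(n\ge4)$, $E^{(1)}_n\,(n=6,7,8)$, $F^{(1)}_4$, $G^{(1)}_2$, $A^{(2)}_{2n}\,(n\ge1)$, $A^{(2)}_{2n-1}\,(n\ge2)$, $D^{(2)}_{n+1}\,(n\ge2)$, $E^{(2)}_6$, $D^{(3)}_4$. Let $\mathfrak g=X_N$ be the simple Lie algebra of rank $N$ and $\sigma$ a Dynkin diagram automorphism of order $r$ ($\sigma=\mathrm{id}$ if $r=1$); let $\mathfrak g_0$ be the $\sigma$-invariant subalgebra: $\mathfrak g_0=X_N$ if $r=1$ (then $n=N$), and $\mathfrak g_0=B_n,C_n,B_n,F_4,G_2$ for $A^{(2)}_{2n},A^{(2)}_{2n-1},D^{(2)}_{n+1},E^{(2)}_6,D^{(3)}_4$ respectively; $n=\mathrm{rank}\,\mathfrak g_0$. Cartan matrices use the convention $A_{ij}=2(\alpha_i,\alpha_j)/(\alpha_i,\alpha_i)$. Let $A'=(A'_{ij})_{i,j\in\{1,\dots,N\}}$ be the Cartan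 matrix of $\mathfrak g$ and $A=(A_{ab})_{a,b\in\{1,\dots,n\}}$ that of $\mathfrak g_0$, whose nodes correspond to the $\sigma$-orbits of nodes of $\mathfrak g$; labelings are chosen so that node $a\in\{1,\dots,n\}$ of $\mathfrak g$ lies in the orbit corresponding to node $a$ of $\mathfrak g_0$ and $A_{ab}<0\iff A'_{ab}<0$ for $a,b\le n$ (for $A^{(2)}_{2n}$: $\mathfrak g=A_{2n}$, nodes $1,\dots,2n$ along the chain, $\sigma(i)=2n+1-i$). Let $d'_i$ be the coprime positive integers with $(d'_iA'_{ij})$ symmetric, and $d_a$ the coprime positive integers with $(d_aA_{ab})$ symmetric. Put $\epsilon'_i=r$ if $\sigma(i)=i$ and $1$ otherwise; $\epsilon_a=2$ if $A'_{a\sigma(a)}<0$ and $1$ otherwise. Combinatorial data. $H=\{(a,m): a\in\{1,\dots,n\},\ m\in\mathbb Z_{\ge1}\}$; $\mathcal N$ is the set of families $N=(N^{(a)}_m)_{(a,m)\in H}$ of nonnegative integers with $\sum N^{(a)}_m<\infty$; $H'(N)=\{(a,m)\in H: N^{(a)}_m>0\}$. For $\nu,N\in\mathcal N$ and $(a,m)\in H$: $\gamma^{(a)}_m=\sum_{k\ge1}\min(m,k)\nu^{(a)}_k$, $P^{(a)}_m(\nu,N)=\gamma^{(a)}_m-\sum_{(b,k)\in H}\frac{A_{ab}}{\epsilon_a d'_b}\min(d'_am,d'_bk)N^{(b)}_k$, $\hat P^{(a)}_m(\nu,N)=\gamma^{(a)}_m-\sum_{(b,k)\in H}\frac{A'_{ab}}{d'_b}\min(d'_am,d'_bk)N^{(b)}_k$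 (these are integers). Writing $P^{(a)}_m$ for $P^{(a)}_m(\nu,N)$, define for triples $(a,m,\alpha),(b,k,\beta)$ with $(a,m),(b,k)\in H'(N)$, $1\le\alpha\le N^{(a)}_m$, $1\le\beta\le N^{(b)}_k$: $A_{am\alpha,bk\beta}=\delta_{ab}\delta_{mk}\delta_{\alpha\beta}(P^{(a)}_m+N^{(a)}_m)+\frac{A_{ba}}{\epsilon_bd'_a}\min(d'_am,d'_bk)-\delta_{ab}\delta_{mk}$. String center equation (SCE) of pattern $N$: the system in unknowns $z^{(a)}_{m\alpha}\in\mathbb C^\times$ ($(a,m)\in H'(N)$, $1\le\alpha\le N^{(a)}_m$) $\prod_{(b,k)\in H'(N)}\prod_{\beta=1}^{N^{(b)}_k}(z^{(b)}_{k\beta})^{A_{am\alpha,bk\beta}}=(-1)^{\hat P^{(a)}_m+N^{(a)}_m+1}$ for all $(a,m)\in H'(N)$, $1\le\alpha\le N^{(a)}_m$. A solution is off-diagonal if $z^{(a)}_{m\alpha}=z^{(a)}_{m\beta}$ only when $\alpha=\beta$. The number $R(\nu,N)$: $R(\nu,0)=1$, and for $N\ne0$, $R(\nu,N)=\Big(\det_{(a,m),(b,k)\in H'(N)}F_{am,bk}\Big)\prod_{(a,m)\in H'(N)}\frac1{N^{(a)}_m}\binom{P^{(a)}_m+N^{(a)}_m-1}{N^{(a)}_m-1}$, where $F_{am,bk}=\delta_{ab}\delta_{mk}P^{(a)}_m+\frac{A_{ba}}{\epsilon_bd'_a}\min(d'_am,d'_bk)N^{(b)}_k$ and $\binom{k}{j}=\frac{\Gamma(k+1)}{\Gamma(k-j+1)\Gamma(j+1)}$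 (for integer $j\ge0$ this is $k(k-1)\cdots(k-j+1)/j!$). *)

theory Defs
  imports Complex_Main "HOL-Combinatorics.Permutations" "HOL-Library.FuncSet"
begin

section \<open>Finite-type Cartan matrices (Bourbaki labelling), A_ij = 2(a_i,a_j)/(a_i,a_i)\<close>

definition cartan_A :: "nat \<Rightarrow> nat \<Rightarrow> nat \<Rightarrow> int" where
  "cartan_A r i j = (if i \<in> {1..r} \<and> j \<in> {1..r} then
     (if i = j then 2 else if i + 1 = j \<or> j + 1 = i then -1 else 0) else 0)"

text \<open>B_r: node r short, so A_{r,r-1} = -2.\<close>
definition cartan_B :: "nat \<Rightarrow> nat \<Rightarrow> nat \<Rightarrow> int" where
  "cartan_B r i j = (if r \<ge> 2 \<and> i = r \<and> j + 1 = r then -2 else cartan_A r i j)"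

text \<open>C_r: node r long, so A_{r-1,r} = -2.\<close>
definition cartan_C :: "nat \<Rightarrow> nat \<Rightarrow> nat \<Rightarrow> int" where
  "cartan_C r i j = (if r \<ge> 2 \<and> i + 1 = r \<and> j = r then -2 else cartan_A r i j)"

definition cartan_D :: "nat \<Rightarrow> nat \<Rightarrow> nat \<Rightarrow> int" where
  "cartan_D r i j = (if i \<in> {1..r} \<and> j \<in> {1..r} then
     (if i = j then 2
      else if ((i + 1 = j \<or> j + 1 = i) \<and> max i j \<le> r - 1)
              \<or> {i, j} = {r - 2, r} then -1 else 0) else 0)"

definition cartan_E :: "nat \<Rightarrow> nat \<Rightarrow> nat \<Rightarrow> int" where
  "cartan_E r i j = (if i \<in> {1..r} \<and> j \<in> {1..r} then
     (if i = j then 2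
      else if {i, j} \<in> {{1,3},{3,4},{4,5},{5,6},{6,7},{7,8},{2,4}} then -1 else 0) else 0)"

text \<open>F_4: 1-2=>3-4, nodes 1,2 long, so A_{3,2} = -2.\<close>
definition cartan_F4 :: "nat \<Rightarrow> nat \<Rightarrow> int" where
  "cartan_F4 i j = (if i = 3 \<and> j = 2 then -2 else cartan_A 4 i j)"

text \<open>G_2: node 1 short, node 2 long, so A_{1,2} = -3, A_{2,1} = -1.\<close>
definition cartan_G2 :: "nat \<Rightarrow> nat \<Rightarrow> int" where
  "cartan_G2 i j = (if i = 1 \<and> j = 2 then -3 else cartan_A 2 i j)"

text \<open>A1 n = A^(1)_n, ..., A2even n = A^(2)_{2n}, A2odd n = A^(2)_{2n-1},
  D2 n = D^(2)_{n+1}, E62 = E^(2)_6, D43 = D^(3)_4.\<close>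
datatype afftype =
    A1 nat | B1 nat | C1 nat | D1 nat | E1 nat | F41 | G21
  | A2even nat | A2odd nat | D2 nat | E62 | D43

fun valid_type :: "afftype \<Rightarrow> bool" where
  "valid_type (A1 n) = (n \<ge> 1)"
| "valid_type (B1 n) = (n \<ge> 3)"
| "valid_type (C1 n) = (n \<ge> 2)"
| "valid_type (D1 n) = (n \<ge> 4)"
| "valid_type (E1 n) = (n \<in> {6,7,8})"
| "valid_type F41 = True"
| "valid_type G21 = True"
| "valid_type (A2even n) = (n \<ge> 1)"
| "valid_type (A2odd n) = (n \<ge> 2)"
| "valid_type (D2 n) = (n \<ge> 2)"
| "valid_type E62 = True"
| "valid_type D43 = True"

fun rank0 :: "afftype \<Rightarrow> nat" where
  "rank0 (A1 n) = n" | "rank0 (B1 n) = n" | "rank0 (C1 n) = n" | "rank0 (D1 n) = n"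
| "rank0 (E1 n) = n" | "rank0 F41 = 4" | "rank0 G21 = 2"
| "rank0 (A2even n) = n" | "rank0 (A2odd n) = n" | "rank0 (D2 n) = n"
| "rank0 E62 = 4" | "rank0 D43 = 2"

fun rankg :: "afftype \<Rightarrow> nat" where
  "rankg (A1 n) = n" | "rankg (B1 n) = n" | "rankg (C1 n) = n" | "rankg (D1 n) = n"
| "rankg (E1 n) = n" | "rankg F41 = 4" | "rankg G21 = 2"
| "rankg (A2even n) = 2 * n" | "rankg (A2odd n) = 2 * n - 1" | "rankg (D2 n) = n + 1"
| "rankg E62 = 6" | "rankg D43 = 4"

text \<open>Labelling of E_6 used for E^(2)_6: node i of g is Bourbaki node e6lab i.
  Then sigma swaps 3,5 and 4,6, and nodes 1..4 form the F_4 chain 1-2=>3-4.\<close>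
definition e6lab :: "nat \<Rightarrow> nat" where
  "e6lab i = (if i = 1 then 2 else if i = 2 then 4 else if i = 4 then 1 else i)"

fun cartang :: "afftype \<Rightarrow> nat \<Rightarrow> nat \<Rightarrow> int" where
  "cartang (A1 n) i j = cartan_A n i j"
| "cartang (B1 n) i j = cartan_B n i j"
| "cartang (C1 n) i j = cartan_C n i j"
| "cartang (D1 n) i j = cartan_D n i j"
| "cartang (E1 n) i j = cartan_E n i j"
| "cartang F41 i j = cartan_F4 i j"
| "cartang G21 i j = cartan_G2 i j"
| "cartang (A2even n) i j = cartan_A (2 * n) i j"
| "cartang (A2odd n) i j = cartan_A (2 * n - 1) i j"
| "cartang (D2 n) i j = cartan_D (n + 1) i j"
| "cartang E62 i j = (if i \<in> {1..6} \<and> j \<in> {1..6} then cartan_E 6 (e6lab i) (e6lab j) else 0)"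
| "cartang D43 i j = cartan_D 4 i j"

fun cartan0 :: "afftype \<Rightarrow> nat \<Rightarrow> nat \<Rightarrow> int" where
  "cartan0 (A1 n) i j = cartan_A n i j"
| "cartan0 (B1 n) i j = cartan_B n i j"
| "cartan0 (C1 n) i j = cartan_C n i j"
| "cartan0 (D1 n) i j = cartan_D n i j"
| "cartan0 (E1 n) i j = cartan_E n i j"
| "cartan0 F41 i j = cartan_F4 i j"
| "cartan0 G21 i j = cartan_G2 i j"
| "cartan0 (A2even n) i j = cartan_B n i j"
| "cartan0 (A2odd n) i j = cartan_C n i j"
| "cartan0 (D2 n) i j = cartan_B n i j"
| "cartan0 E62 i j = cartan_F4 i j"
| "cartan0 D43 i j = cartan_G2 i j"

text \<open>Diagram automorphism sigma of g (identity for r = 1)\<close>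
fun sigma :: "afftype \<Rightarrow> nat \<Rightarrow> nat" where
  "sigma (A2even n) i = (if i \<in> {1..2*n} then 2 * n + 1 - i else i)"
| "sigma (A2odd n) i = (if i \<in> {1..2*n-1} then 2 * n - i else i)"
| "sigma (D2 n) i = (if i = n then n + 1 else if i = n + 1 then n else i)"
| "sigma E62 i = (if i = 3 then 5 else if i = 5 then 3 else if i = 4 then 6 else if i = 6 then 4 else i)"
| "sigma D43 i = (if i = 1 then 3 else if i = 3 then 4 else if i = 4 then 1 else i)"
| "sigma t i = i"

text \<open>d'_i: the coprime positive symmetrizing integers of A' (written out explicitly;
  g is simply laced in the twisted cases).\<close>
fun dprime :: "afftype \<Rightarrow> nat \<Rightarrow> nat" where
  "dprime (B1 n) i = (if i = n then 1 else 2)"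
| "dprime (C1 n) i = (if i = n then 2 else 1)"
| "dprime F41 i = (if i \<le> 2 then 2 else 1)"
| "dprime G21 i = (if i = 2 then 3 else 1)"
| "dprime t i = 1"

definition eps :: "afftype \<Rightarrow> nat \<Rightarrow> nat" where
  "eps t a = (if cartang t a (sigma t a) < 0 then 2 else 1)"

definition Hset :: "afftype \<Rightarrow> (nat \<times> nat) set" where
  "Hset t = {(a, m). 1 \<le> a \<and> a \<le> rank0 t \<and> 1 \<le> m}"

definition in_calN :: "afftype \<Rightarrow> (nat \<Rightarrow> nat \<Rightarrow> nat) \<Rightarrow> bool" where
  "in_calN t N \<longleftrightarrow> (\<forall>a m. (a, m) \<notin> Hset t \<longrightarrow> N a m = 0) \<and> finite {(a, m). N a m \<noteq> 0}"

definition Hprime :: "afftype \<Rightarrow> (nat \<Rightarrow> nat \<Rightarrow> nat) \<Rightarrow> (nat \<times> nat) set" where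
  "Hprime t N = {(a, m) \<in> Hset t. N a m > 0}"

definition gam :: "(nat \<Rightarrow> nat \<Rightarrow> nat) \<Rightarrow> nat \<Rightarrow> nat \<Rightarrow> real" where
  "gam \<nu> a m = (\<Sum>k \<in> {k. 1 \<le> k \<and> \<nu> a k \<noteq> 0}. real (min m k * \<nu> a k))"

definition coef :: "afftype \<Rightarrow> nat \<Rightarrow> nat \<Rightarrow> nat \<Rightarrow> nat \<Rightarrow> real" where
  "coef t a m b k = real_of_int (cartan0 t a b) / real (eps t a * dprime t b)
                     * real (min (dprime t a * m) (dprime t b * k))"

definition Pvac :: "afftype \<Rightarrow> (nat \<Rightarrow> nat \<Rightarrow> nat) \<Rightarrow> (nat \<Rightarrow> nat \<Rightarrow> nat) \<Rightarrow> nat \<Rightarrow> nat \<Rightarrow> real" where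
  "Pvac t \<nu> N a m = gam \<nu> a m - (\<Sum>(b, k) \<in> Hprime t N. coef t a m b k * real (N b k))"

definition Phat :: "afftype \<Rightarrow> (nat \<Rightarrow> nat \<Rightarrow> nat) \<Rightarrow> (nat \<Rightarrow> nat \<Rightarrow> nat) \<Rightarrow> nat \<Rightarrow> nat \<Rightarrow> real" where
  "Phat t \<nu> N a m = gam \<nu> a m - (\<Sum>(b, k) \<in> Hprime t N.
       real_of_int (cartang t a b) / real (dprime t b)
       * real (min (dprime t a * m) (dprime t b * k)) * real (N b k))"

definition Tidx :: "afftype \<Rightarrow> (nat \<Rightarrow> nat \<Rightarrow> nat) \<Rightarrow> (nat \<times> nat \<times> nat) set" where
  "Tidx t N = {(a, m, \<alpha>). (a, m) \<in> Hprime t N \<and> 1 \<le> \<alpha> \<and> \<alpha> \<le> N a m}"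

text \<open>The matrix A_{am alpha, bk beta}; note the second term is coef t b k a m.\<close>
definition Amat :: "afftype \<Rightarrow> (nat \<Rightarrow> nat \<Rightarrow> nat) \<Rightarrow> (nat \<Rightarrow> nat \<Rightarrow> nat)
     \<Rightarrow> nat \<times> nat \<times> nat \<Rightarrow> nat \<times> nat \<times> nat \<Rightarrow> real" where
  "Amat t \<nu> N i j = (case i of (a, m, \<alpha>) \<Rightarrow> case j of (b, k, \<beta>) \<Rightarrow>
      (if a = b \<and> m = k \<and> \<alpha> = \<beta> then Pvac t \<nu> N a m + real (N a m) else 0)
      + real_of_int (cartan0 t b a) / real (eps t b * dprime t a)
          * real (min (dprime t a * m) (dprime t b * k))
      - (if a = b \<and> m = k then 1 else 0))"

text \<open>Solutions of the string center equation (these exponents are integers, so floor is exact).\<close>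
definition sce_solutions :: "afftype \<Rightarrow> (nat \<Rightarrow> nat \<Rightarrow> nat) \<Rightarrow> (nat \<Rightarrow> nat \<Rightarrow> nat)
     \<Rightarrow> (nat \<times> nat \<times> nat \<Rightarrow> complex) set" where
  "sce_solutions t \<nu> N = {z \<in> Tidx t N \<rightarrow>\<^sub>E (UNIV - {0}).
     \<forall>i \<in> Tidx t N. (case i of (a, m, \<alpha>) \<Rightarrow>
        (\<Prod>j \<in> Tidx t N. z j powi \<lfloor>Amat t \<nu> N i j\<rfloor>)
          = (-1) powi (\<lfloor>Phat t \<nu> N a m\<rfloor> + int (N a m) + 1))}"

definition off_diagonal :: "(nat \<times> nat \<times> nat) set \<Rightarrow> (nat \<times> nat \<times> nat \<Rightarrow> complex) \<Rightarrow> bool" where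
  "off_diagonal T z \<longleftrightarrow> (\<forall>a m \<alpha> \<beta>. (a, m, \<alpha>) \<in> T \<longrightarrow> (a, m, \<beta>) \<in> T \<longrightarrow>
      z (a, m, \<alpha>) = z (a, m, \<beta>) \<longrightarrow> \<alpha> = \<beta>)"

definition offdiag_solutions :: "afftype \<Rightarrow> (nat \<Rightarrow> nat \<Rightarrow> nat) \<Rightarrow> (nat \<Rightarrow> nat \<Rightarrow> nat)
     \<Rightarrow> (nat \<times> nat \<times> nat \<Rightarrow> complex) set" where
  "offdiag_solutions t \<nu> N = {z \<in> sce_solutions t \<nu> N. off_diagonal (Tidx t N) z}"

definition Fmat :: "afftype \<Rightarrow> (nat \<Rightarrow> nat \<Rightarrow> nat) \<Rightarrow> (nat \<Rightarrow> nat \<Rightarrow> nat)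
     \<Rightarrow> nat \<times> nat \<Rightarrow> nat \<times> nat \<Rightarrow> real" where
  "Fmat t \<nu> N i j = (case i of (a, m) \<Rightarrow> case j of (b, k) \<Rightarrow>
      (if a = b \<and> m = k then Pvac t \<nu> N a m else 0)
      + real_of_int (cartan0 t b a) / real (eps t b * dprime t a)
          * real (min (dprime t a * m) (dprime t b * k)) * real (N b k))"

definition det_on :: "'a set \<Rightarrow> ('a \<Rightarrow> 'a \<Rightarrow> real) \<Rightarrow> real" where
  "det_on S M = (\<Sum>p \<in> {p. p permutes S}. real_of_int (sign p) * (\<Prod>i \<in> S. M i (p i)))"

definition Rnum :: "afftype \<Rightarrow> (nat \<Rightarrow> nat \<Rightarrow> nat) \<Rightarrow> (nat \<Rightarrow> nat \<Rightarrow> nat) \<Rightarrow> real" where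
  "Rnum t \<nu> N = (if Hprime t N = {} then 1 else
     det_on (Hprime t N) (Fmat t \<nu> N) *
     (\<Prod>(a, m) \<in> Hprime t N. (1 / real (N a m)) *
        ((Pvac t \<nu> N a m + real (N a m) - 1) gchoose (N a m - 1))))"

end

theory Submission
  imports Defs
begin

text \<open>
  Within a string \<open>(a, m)\<close> the equations differ only by the power \<open>P + N\<close> of the unknown \<open>z\<^sub>\<alpha>\<close>, so
  the entries of an off-diagonal solution are the first entry times distinct \<open>(P + N)\<close>-th roots of
  unity. This leaves \<open>(P + N - 1)! / P!\<close> choices per string, and for each choice the first entries
  solve a monomial system whose exponent matrix is exactly \<open>F\<close>; by integer row operations it has
  \<open>\<bar>det F\<bar>\<close> solutions. Finally \<open>det F > 0\<close>: after a positive rescaling of its columns \<open>F\<close> becomes a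
  nonnegative diagonal matrix plus a Cartan form weighted by \<open>min\<close>, and \<open>min\<close> is a Gram kernel.
\<close>

section \<open>Determinants and monomial systems\<close>

text \<open>Why the exponents collapse to \<open>F\<close>: write the entries of string j as w_j
  times ratios. The N_j copies of w_j multiply each entry B - delta by N_j, and the N in the
  diagonal term P + N cancels the N copies of -1, leaving P delta + B N. The ratios survive only as
  a nonzero factor that moves to the right-hand side, and a nonsingular monomial system has equally
  many solutions for every nonzero right-hand side; hence the two kinds of choices multiply. The
  monomial count yields det F only up to sign and only if it is nonzero, so positivity is
  indispensable for the stated formula. F is not symmetric, since N_j sits in column j and the
  Cartan matrix may have roots of two lengths; the column weights repair both. Definiteness of the
  Cartan form is certified without root systems: a symmetrizable matrix with nonpositive
  off-diagonal entries is positive definite once some positive vector h has A h > 0 in every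
  coordinate, and such an h is written down for each type.\<close>

lemma det_on_cong:
  assumes "\<And>i j. i \<in> S \<Longrightarrow> j \<in> S \<Longrightarrow> M i j = M' i j"
  shows "det_on S M = det_on S M'"
  unfolding det_on_def
  by (intro sum.cong refl arg_cong2[where f="(*)"] prod.cong assms) (auto simp: permutes_in_image)

lemma det_on_equal_rows:
  assumes "finite S" "i \<in> S" "k \<in> S" "i \<noteq> k" "M i = M k"
  shows "det_on S M = 0"
proof -
  let ?\<tau> = "transpose i k"
  have \<tau>: "?\<tau> permutes S" using assms by (simp add: permutes_swap_id)
  have "det_on S M = (\<Sum>p | p permutes S. real_of_int (sign (p \<circ> ?\<tau>)) * (\<Prod>l\<in>S. M l ((p \<circ> ?\<tau>) l)))"
    unfolding det_on_def using sum_permutations_compose_right[OF \<tau>] by blast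
  also have "\<dots> = (\<Sum>p | p permutes S. - (real_of_int (sign p) * (\<Prod>l\<in>S. M l (p l))))"
  proof (rule sum.cong[OF refl])
    fix p assume "p \<in> {p. p permutes S}"
    then have p: "p permutes S" by simp
    have s: "sign (p \<circ> ?\<tau>) = - sign p"
      using p \<tau> assms
      by (subst sign_compose) (auto simp: sign_swap_id intro: permutes_imp_permutation[OF \<open>finite S\<close>])
    have "(\<Prod>l\<in>S. M l ((p \<circ> ?\<tau>) l)) = (\<Prod>l\<in>S. M (?\<tau> l) (p (?\<tau> l)))"
      by (rule prod.cong) (use assms in \<open>auto simp: transpose_def\<close>)
    also have "\<dots> = (\<Prod>l\<in>S. M l (p l))"
      using permutes_imp_bij[OF \<tau>] by (rule prod.reindex_bij_betw)
    finally show "real_of_int (sign (p \<circ> ?\<tau>)) * (\<Prod>l\<in>S. M l ((p \<circ> ?\<tau>) l)) =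
        - (real_of_int (sign p) * (\<Prod>l\<in>S. M l (p l)))" using s by simp
  qed
  also have "\<dots> = - det_on S M" by (simp add: det_on_def sum_negf)
  finally show ?thesis by simp
qed

lemma det_on_row_add:
  assumes "finite S" "i \<in> S" "k \<in> S" "i \<noteq> k"
  shows "det_on S (M(i := \<lambda>l. M i l + q * M k l)) = det_on S M"
proof -
  have expand: "(\<Prod>l\<in>S. (M(i := r)) l (p l)) = r (p i) * (\<Prod>l\<in>S - {i}. M l (p l))" for r p
    using assms by (simp add: prod.remove)
  have "det_on S (M(i := \<lambda>l. M i l + q * M k l)) =
      det_on S (M(i := M i)) + q * det_on S (M(i := M k))"
    unfolding det_on_def expand by (simp add: algebra_simps sum.distrib sum_distrib_left)
  moreover have "det_on S (M(i := M k)) = 0"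
    by (rule det_on_equal_rows[OF assms]) (use assms in auto)
  ultimately show ?thesis unfolding fun_upd_triv by (simp only: mult_zero_right add_0_right)
qed

text \<open>A permutation that moves \<open>j\<close> takes its entry of column \<open>j\<close>
  from a row in \<open>S\<close>, where that column vanishes; only the permutations of
  \<open>S\<close> survive.\<close>

lemma det_on_insert:
  assumes "finite S" "j \<notin> S" "\<And>i. i \<in> S \<Longrightarrow> M i j = 0"
  shows "det_on (insert j S) M = M j j * det_on S M"
proof -
  let ?t = "\<lambda>p. real_of_int (sign p) * (\<Prod>l\<in>insert j S. M l (p l))"
  have sub: "{p. p permutes S} \<subseteq> {p. p permutes insert j S}"
    by (auto intro: permutes_subset)
  have "det_on (insert j S) M = sum ?t {p. p permutes S}"
    unfolding det_on_def
  proof (rule sum.mono_neutral_right[OF _ sub], goal_cases)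
    case 1 then show ?case using assms by (simp add: finite_permutations)
  next
    case 2
    show ?case
    proof
      fix p assume "p \<in> {p. p permutes insert j S} - {p. p permutes S}"
      then have p: "p permutes insert j S" "\<not> p permutes S" by auto
      have "p j \<noteq> j"
      proof
        assume "p j = j"
        then have "p permutes (insert j S - {j})"
          by (intro permutes_superset[OF p(1)]) auto
        with p assms show False by (simp add: Diff_insert0)
      qed
      obtain i where i: "p i = j" using permutes_surj[OF p(1)] by (metis surj_def)
      have "i \<noteq> j" using i \<open>p j \<noteq> j\<close> by auto
      moreover have "i \<in> insert j S"
        using i p(1) by (metis permutes_in_image insertI1)
      ultimately have "i \<in> S" by auto
      then have "(\<Prod>l\<in>insert j S. M l (p l)) = 0"
        using assms i by (intro prod_zero) auto
      then show "?t p = 0" by simp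
    qed
  qed
  also have "\<dots> = (\<Sum>p | p permutes S. M j j * (real_of_int (sign p) * (\<Prod>l\<in>S. M l (p l))))"
    using assms by (intro sum.cong refl) (auto simp: permutes_not_in)
  finally show ?thesis by (simp add: det_on_def sum_distrib_left)
qed

lemma det_on_scale_columns:
  "det_on S (\<lambda>i j. M i j * u j) = det_on S M * (\<Prod>j\<in>S. u j)"
proof -
  have "(\<Prod>i\<in>S. u (p i)) = (\<Prod>j\<in>S. u j)" if "p permutes S" for p
    using permutes_imp_bij[OF that] by (rule prod.reindex_bij_betw)
  then show ?thesis
    unfolding det_on_def sum_distrib_right
    by (intro sum.cong refl) (simp add: prod.distrib)
qed

text \<open>Gaussian elimination with pivot row \<open>j\<close>, by induction on the set
  \<open>T\<close> of rows already treated. As \<open>j\<close> is never in \<open>T\<close>, each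
  step subtracts a multiple of the original pivot row.\<close>

lemma det_on_clear_column:
  assumes "finite S" "j \<notin> S" "T \<subseteq> S"
  shows "det_on (insert j S) (\<lambda>i l. if i \<in> T then M i l - c i * M j l else M i l) =
    det_on (insert j S) M"
proof -
  have "finite T" using assms finite_subset by blast
  then show ?thesis using assms(3)
  proof (induction T)
    case (insert i T)
    let ?M = "\<lambda>i l. if i \<in> T then M i l - c i * M j l else M i l"
    have "det_on (insert j S) (?M(i := \<lambda>l. ?M i l + (- c i) * ?M j l)) = det_on (insert j S) ?M"
      by (rule det_on_row_add) (use assms insert in auto)
    also have "?M(i := \<lambda>l. ?M i l + (- c i) * ?M j l) =
        (\<lambda>i' l. if i' \<in> insert i T then M i' l - c i' * M j l else M i' l)"
      using insert assms by (auto simp: fun_eq_iff)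
    finally show ?case using insert by auto
  qed simp
qed

text \<open>The Schur complement of a diagonal entry inherits positivity.\<close>
lemma det_on_pos:
  fixes M :: "'a \<Rightarrow> 'a \<Rightarrow> real"
  assumes "finite S"
    and "\<And>x. \<exists>i\<in>S. x i \<noteq> 0 \<Longrightarrow> (\<Sum>i\<in>S. \<Sum>j\<in>S. M i j * x i * x j) > 0"
  shows "det_on S M > 0"
  using assms
proof (induction S arbitrary: M rule: finite_induct)
  case empty
  then show ?case by (simp add: det_on_def)
next
  case (insert j S)
  have quad: "(\<Sum>i\<in>insert j S. \<Sum>l\<in>insert j S. M i l * x i * x l) =
      x j * (M j j * x j + (\<Sum>l\<in>S. M j l * x l)) + (\<Sum>i\<in>S. x i * (M i j * x j + (\<Sum>l\<in>S. M i l * x l)))" for x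
    using insert(1,2) by (simp add: algebra_simps sum_distrib_left sum_distrib_right sum.distrib)
  have pivot: "M j j > 0"
  proof -
    define x :: "'a \<Rightarrow> real" where "x = (\<lambda>i. if i = j then 1 else 0)"
    have x: "x j = 1" "\<And>i. i \<in> S \<Longrightarrow> x i = 0" using insert(2) by (auto simp: x_def)
    then have "0 < (\<Sum>i\<in>insert j S. \<Sum>l\<in>insert j S. M i l * x i * x l)"
      by (intro insert.prems) auto
    then show ?thesis unfolding quad by (simp add: x)
  qed
  define K where "K = (\<lambda>i l. M i l - M i j / M j j * M j l)"
  have "det_on S K > 0"
  proof (rule insert.IH)
    fix y :: "'a \<Rightarrow> real" assume y: "\<exists>i\<in>S. y i \<noteq> 0"
    define r where "r = (\<Sum>l\<in>S. M j l * y l)"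
    \<comment> \<open>The value at \<open>j\<close> is chosen so that row \<open>j\<close> of
      \<open>M\<close> annihilates \<open>x\<close>; the first summand of \<open>quad\<close> then
      vanishes, and what remains is the form of the Schur complement \<open>K\<close> at
      \<open>y\<close>.\<close>
    define x where "x = y(j := - r / M j j)"
    have x: "x j = - r / M j j" "\<And>i. i \<in> S \<Longrightarrow> x i = y i" using insert(2) by (auto simp: x_def)
    have rx: "(\<Sum>l\<in>S. M i l * x l) = (\<Sum>l\<in>S. M i l * y l)" for i using x by (intro sum.cong) auto
    have "0 < (\<Sum>i\<in>insert j S. \<Sum>l\<in>insert j S. M i l * x i * x l)"
      using y x insert.prems[of x] by auto
    also have "\<dots> = (\<Sum>i\<in>S. y i * (M i j * x j + (\<Sum>l\<in>S. M i l * y l)))"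
      unfolding quad rx using pivot x by (simp add: r_def[symmetric])
    also have "\<dots> = (\<Sum>i\<in>S. \<Sum>l\<in>S. K i l * y i * y l)"
    proof (rule sum.cong[OF refl])
      fix i
      have "M i j * x j = - (\<Sum>l\<in>S. M i j / M j j * M j l * y l)"
        unfolding x r_def by (simp add: sum_distrib_left mult.assoc sum_negf[symmetric] sum_divide_distrib)
      then have "M i j * x j + (\<Sum>l\<in>S. M i l * y l) = (\<Sum>l\<in>S. K i l * y l)"
        by (simp add: K_def algebra_simps sum_subtractf)
      then show "y i * (M i j * x j + (\<Sum>l\<in>S. M i l * y l)) = (\<Sum>l\<in>S. K i l * y i * y l)"
        by (simp add: sum_distrib_left algebra_simps)
    qed
    finally show "0 < (\<Sum>i\<in>S. \<Sum>l\<in>S. K i l * y i * y l)" .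
  qed
  let ?K' = "\<lambda>i l. if i \<in> S then M i l - M i j / M j j * M j l else M i l"
  have "det_on (insert j S) M = det_on (insert j S) ?K'"
    using det_on_clear_column[of S j S M "\<lambda>i. M i j / M j j"] insert(1,2) by simp
  also have "\<dots> = M j j * det_on S ?K'"
    using insert(1,2) pivot by (subst det_on_insert) auto
  also have "det_on S ?K' = det_on S K" by (rule det_on_cong) (simp add: K_def)
  finally show ?case using pivot \<open>det_on S K > 0\<close> by simp
qed

text \<open>Euclid's algorithm on column \<open>j\<close>, packaged as an induction rule: while two
  entries of the column are nonzero, one can be shortened by the other, which lowers the sum of
  absolute values. Row addition is the only move, so users have a single invariance to
  prove.\<close>

lemma euclid_row_induct:
  fixes G :: "'a \<Rightarrow> 'a \<Rightarrow> int"
  assumes fin: "finite S" and j: "j \<in> S"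
    and base: "\<And>G. (\<And>i. i \<in> S \<Longrightarrow> i \<noteq> j \<Longrightarrow> G i j = 0) \<Longrightarrow> P G"
    and step: "\<And>G i k q. i \<in> S \<Longrightarrow> k \<in> S \<Longrightarrow> i \<noteq> k \<Longrightarrow> P (G(i := \<lambda>l. G i l + q * G k l)) \<Longrightarrow> P G"
  shows "P G"
proof (induction "\<Sum>i\<in>S. nat \<bar>G i j\<bar>" arbitrary: G rule: less_induct)
  case less
  show ?case
  proof (cases "\<exists>i\<in>S. \<exists>k\<in>S. i \<noteq> k \<and> G k j \<noteq> 0 \<and> \<bar>G k j\<bar> \<le> \<bar>G i j\<bar>")
    case True
    then obtain i k where ik: "i \<in> S" "k \<in> S" "i \<noteq> k" "G k j \<noteq> 0" "\<bar>G k j\<bar> \<le> \<bar>G i j\<bar>" by blast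
    \<comment> \<open>A single subtraction in place of division with remainder: with this sign the
      new absolute value is the difference of the two old ones.\<close>
    define q where "q = - sgn (G i j) * sgn (G k j)"
    have dec: "\<bar>G i j + q * G k j\<bar> < \<bar>G i j\<bar>"
      using ik unfolding q_def by (auto simp: sgn_if abs_if split: if_splits)
    let ?G = "G(i := \<lambda>l. G i l + q * G k l)"
    have "(\<Sum>i\<in>S. nat \<bar>?G i j\<bar>) < (\<Sum>i\<in>S. nat \<bar>G i j\<bar>)"
      by (rule sum_strict_mono_ex1[OF fin]) (use ik dec in auto)
    then have "P ?G" by (rule less)
    then show ?thesis by (rule step[OF ik(1-3)])
  next
    case False
    have one: "i = k" if "i \<in> S" "k \<in> S" "G i j \<noteq> 0" "G k j \<noteq> 0" for i k
    proof (rule ccontr)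
      assume "i \<noteq> k"
      then have "\<not> \<bar>G k j\<bar> \<le> \<bar>G i j\<bar>" "\<not> \<bar>G i j\<bar> \<le> \<bar>G k j\<bar>"
        using False that by metis+
      then show False by linarith
    qed
    show ?thesis
    proof (cases "\<exists>i\<in>S. i \<noteq> j \<and> G i j \<noteq> 0")
      case True
      then obtain i where i: "i \<in> S" "i \<noteq> j" "G i j \<noteq> 0" by blast
      then have z: "k \<in> S \<Longrightarrow> k \<noteq> i \<Longrightarrow> G k j = 0" for k using one by blast
      \<comment> \<open>The only nonzero entry sits in row \<open>i\<close>, and
        \<open>G j j = 0\<close>. Adding row \<open>i\<close> to row \<open>j\<close> and then
        subtracting row \<open>j\<close> from row \<open>i\<close> moves it to row \<open>j\<close>.
        The measure does not drop here, so \<open>base\<close> is used and not the induction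
        hypothesis.\<close>
      let ?G1 = "G(j := \<lambda>l. G j l + 1 * G i l)"
      let ?G2 = "?G1(i := \<lambda>l. ?G1 i l + (-1) * ?G1 j l)"
      have "P ?G2" by (rule base) (use z i j in auto)
      then have "P ?G1" by (rule step[OF i(1) j i(2)])
      then show ?thesis by (rule step[OF j i(1) i(2)[symmetric]])
    next
      case False
      then show ?thesis using base by blast
    qed
  qed
qed

section \<open>Monomial systems in the complex torus\<close>

definition monomial_sols :: "'a set \<Rightarrow> ('a \<Rightarrow> 'a \<Rightarrow> int) \<Rightarrow> ('a \<Rightarrow> complex) \<Rightarrow> ('a \<Rightarrow> complex) set" where
  "monomial_sols S G c = {w \<in> S \<rightarrow>\<^sub>E (UNIV - {0}). \<forall>i\<in>S. (\<Prod>j\<in>S. w j powi G i j) = c i}"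

lemma card_roots_powi:
  fixes c d :: complex
  assumes "e \<noteq> 0" "c \<noteq> 0" "d \<noteq> 0"
  shows "finite {x. x \<noteq> 0 \<and> x powi e * d = c} \<and> card {x. x \<noteq> 0 \<and> x powi e * d = c} = nat \<bar>e\<bar>"
proof -
  \<comment> \<open>For negative \<open>e\<close> the equation is inverted, so that both signs ask
    for roots of order |e|.\<close>
  define b where "b = (if e > 0 then c / d else d / c)"
  have "b \<noteq> 0" using assms by (simp add: b_def)
  have "{x. x \<noteq> 0 \<and> x powi e * d = c} = {x. x ^ nat \<bar>e\<bar> = b}"
    using assms \<open>b \<noteq> 0\<close> by (auto simp: b_def power_int_def field_simps power_0_left split: if_splits)
  moreover have "nat \<bar>e\<bar> > 0" using assms by simp
  ultimately show ?thesis
    using card_nth_roots[OF \<open>b \<noteq> 0\<close>, of "nat \<bar>e\<bar>"] finite_nth_roots[of "nat \<bar>e\<bar>" b] by simp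
qed

lemma prod_powi:
  fixes f :: "'a \<Rightarrow> complex"
  shows "(\<Prod>j\<in>S. f j powi q) = (\<Prod>j\<in>S. f j) powi q"
  by (induction S rule: infinite_finite_induct) (auto simp: power_int_mult_distrib)

text \<open>The new equation \<open>i\<close> is the old one times the \<open>q\<close>-th power of
  equation \<open>k\<close>. Equation \<open>k\<close> itself is kept and \<open>c k\<close> is
  nonzero, so the factor can be cancelled again.\<close>

lemma monomial_sols_row_add:
  assumes "finite S" "i \<in> S" "k \<in> S" "i \<noteq> k" "\<And>i. i \<in> S \<Longrightarrow> c i \<noteq> 0"
  shows "monomial_sols S (G(i := \<lambda>l. G i l + q * G k l)) (c(i := c i * c k powi q)) = monomial_sols S G c"
proof -
  let ?G = "G(i := \<lambda>l. G i l + q * G k l)" and ?c = "c(i := c i * c k powi q)"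
  have eq: "(\<forall>l\<in>S. (\<Prod>j\<in>S. w j powi ?G l j) = ?c l) \<longleftrightarrow> (\<forall>l\<in>S. (\<Prod>j\<in>S. w j powi G l j) = c l)"
    if w: "w \<in> S \<rightarrow>\<^sub>E (UNIV - {0})" for w
  proof -
    have nz: "w j \<noteq> 0" if "j \<in> S" for j using that w by auto
    have row: "(\<Prod>j\<in>S. w j powi ?G i j) = (\<Prod>j\<in>S. w j powi G i j) * (\<Prod>j\<in>S. w j powi G k j) powi q"
    proof -
      have "(\<Prod>j\<in>S. w j powi ?G i j) = (\<Prod>j\<in>S. w j powi G i j * (w j powi G k j) powi q)"
        using nz by (intro prod.cong refl) (simp add: power_int_add power_int_mult[symmetric] mult.commute)
      then show ?thesis by (simp add: prod.distrib prod_powi)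
    qed
    show ?thesis
    proof (intro iffI ballI)
      fix l assume *: "\<forall>l\<in>S. (\<Prod>j\<in>S. w j powi ?G l j) = ?c l" and l: "l \<in> S"
      from *[rule_format, OF \<open>k \<in> S\<close>] have k: "(\<Prod>j\<in>S. w j powi G k j) = c k" using assms(4) by simp
      show "(\<Prod>j\<in>S. w j powi G l j) = c l"
      proof (cases "l = i")
        case True
        from *[rule_format, OF \<open>i \<in> S\<close>] show ?thesis unfolding row k True
          using assms by simp
      qed (use *[rule_format, OF l] in simp)
    next
      fix l assume "\<forall>l\<in>S. (\<Prod>j\<in>S. w j powi G l j) = c l" and "l \<in> S"
      then show "(\<Prod>j\<in>S. w j powi ?G l j) = ?c l"
        using row assms by (cases "l = i") auto
    qed
  qed
  show ?thesis unfolding monomial_sols_def using eq by blast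
qed

text \<open>With column \<open>j\<close> cleared, the unknown \<open>j\<close> occurs in equation
  \<open>j\<close> alone: each solution of the system on \<open>S\<close> extends by the roots of
  one binomial equation of degree |G j j|.\<close>

lemma card_monomial_sols_insert:
  assumes S: "finite S" "j \<notin> S" and z: "\<And>i. i \<in> S \<Longrightarrow> G i j = 0"
    and e: "G j j \<noteq> 0" and c: "c j \<noteq> 0" and fin: "finite (monomial_sols S G c)"
  shows "finite (monomial_sols (insert j S) G c) \<and>
    card (monomial_sols (insert j S) G c) = nat \<bar>G j j\<bar> * card (monomial_sols S G c)"
proof -
  let ?X = "\<lambda>w. {x. x \<noteq> 0 \<and> x powi G j j * (\<Prod>l\<in>S. w l powi G j l) = c j}"
  let ?f = "\<lambda>(w, x). w(j := x)"
  let ?D = "Sigma (monomial_sols S G c) ?X"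
  have X: "finite (?X w) \<and> card (?X w) = nat \<bar>G j j\<bar>" if "w \<in> monomial_sols S G c" for w
  proof (rule card_roots_powi[OF e c])
    show "(\<Prod>l\<in>S. w l powi G j l) \<noteq> 0"
      using that S(1) by (auto simp: monomial_sols_def)
  qed
  have upd: "(\<Prod>l\<in>S. (w(j := x)) l powi G i l) = (\<Prod>l\<in>S. w l powi G i l)" for w i and x :: complex
    using S by (intro prod.cong) auto
  have inj: "inj_on ?f ?D"
  proof (rule inj_onI, clarsimp)
    fix w x w' x'
    assume w: "w \<in> monomial_sols S G c" "w' \<in> monomial_sols S G c" and eq: "w(j := x) = w'(j := x')"
    \<comment> \<open>Extensionality fixes the value at \<open>j\<close> outside \<open>S\<close>,
      so the update at \<open>j\<close> loses no information.\<close>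
    have "w j = undefined" "w' j = undefined" using w S by (auto simp: monomial_sols_def PiE_def extensional_def)
    with eq show "w = w' \<and> x = x'" by (metis fun_upd_same fun_upd_triv fun_upd_upd)
  qed
  have img: "?f ` ?D = monomial_sols (insert j S) G c"
  proof (intro equalityI subsetI)
    fix v assume "v \<in> ?f ` ?D"
    then obtain w x where w: "w \<in> monomial_sols S G c" and x: "x \<in> ?X w" and v: "v = w(j := x)" by auto
    have "(\<Prod>l\<in>insert j S. v l powi G i l) = c i" if "i \<in> insert j S" for i
      using that S z w x by (auto simp: v upd monomial_sols_def simp del: fun_upd_apply) auto
    moreover have "v \<in> insert j S \<rightarrow>\<^sub>E (UNIV - {0})" using w x S by (auto simp: v monomial_sols_def PiE_def extensional_def)
    ultimately show "v \<in> monomial_sols (insert j S) G c" by (simp add: monomial_sols_def)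
  next
    fix v assume v: "v \<in> monomial_sols (insert j S) G c"
    let ?w = "v(j := undefined)"
    have eqs: "v j powi G i j * (\<Prod>l\<in>S. v l powi G i l) = c i" if "i \<in> insert j S" for i
      using v S that by (auto simp: monomial_sols_def)
    have "?w \<in> monomial_sols S G c"
      using v eqs z S by (auto simp: monomial_sols_def upd PiE_def extensional_def simp del: fun_upd_apply) (auto simp: upd)
    moreover have "v j \<in> ?X ?w" using v eqs[of j] by (auto simp: upd monomial_sols_def simp del: fun_upd_apply)
    ultimately show "v \<in> ?f ` ?D" by (intro image_eqI[of _ _ "(?w, v j)"]) auto
  qed
  have "finite ?D" using fin X by auto
  moreover have "card ?D = nat \<bar>G j j\<bar> * card (monomial_sols S G c)"
    using fin X by simp
  ultimately show ?thesis unfolding img[symmetric] using card_image[OF inj] by simp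
qed

text \<open>The count is the index of the lattice spanned by the rows of \<open>G\<close>. Row
  additions preserve both sides, and once column \<open>j\<close> is cleared both sides acquire the
  factor |G j j|.\<close>

lemma card_monomial_sols:
  fixes G :: "'a \<Rightarrow> 'a \<Rightarrow> int"
  assumes "finite S" "det_on S (\<lambda>i j. of_int (G i j)) \<noteq> 0" "\<And>i. i \<in> S \<Longrightarrow> c i \<noteq> 0"
  shows "finite (monomial_sols S G c) \<and>
    real (card (monomial_sols S G c)) = \<bar>det_on S (\<lambda>i j. of_int (G i j))\<bar>"
  using assms
proof (induction S arbitrary: G c rule: finite_induct)
  case empty
  have "monomial_sols {} G c = {\<lambda>_. undefined}" by (auto simp: monomial_sols_def)
  then show ?case by (simp add: det_on_def)
next
  case (insert j S)
  let ?d = "\<lambda>G. det_on (insert j S) (\<lambda>i j. of_int (G i j))"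
  \<comment> \<open>The right-hand side is quantified inside \<open>?P\<close> because a row
    addition on \<open>G\<close> changes \<open>c\<close> as well.\<close>
  let ?P = "\<lambda>G. \<forall>c. ?d G \<noteq> 0 \<longrightarrow> (\<forall>i\<in>insert j S. c i \<noteq> 0) \<longrightarrow> finite (monomial_sols (insert j S) G c) \<and>
    real (card (monomial_sols (insert j S) G c)) = \<bar>?d G\<bar>"
  have "?P G"
  proof (rule euclid_row_induct[of "insert j S" j ?P])
    fix G :: "'a \<Rightarrow> 'a \<Rightarrow> int" assume z: "\<And>i. i \<in> insert j S \<Longrightarrow> i \<noteq> j \<Longrightarrow> G i j = 0"
    then have z': "\<And>i. i \<in> S \<Longrightarrow> G i j = 0" using insert(2) by auto
    have d: "?d G = of_int (G j j) * det_on S (\<lambda>i j. of_int (G i j))"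
      using insert(1,2) z' by (subst det_on_insert) auto
    show "?P G"
    proof (intro allI impI)
      fix c :: "'a \<Rightarrow> complex" assume nz: "?d G \<noteq> 0" and c: "\<forall>i\<in>insert j S. c i \<noteq> 0"
      then have IH: "finite (monomial_sols S G c) \<and>
          real (card (monomial_sols S G c)) = \<bar>det_on S (\<lambda>i j. of_int (G i j))\<bar>"
        using d by (intro insert.IH) auto
      then show "finite (monomial_sols (insert j S) G c) \<and>
          real (card (monomial_sols (insert j S) G c)) = \<bar>?d G\<bar>"
        using card_monomial_sols_insert[of S j G c] z' insert(1,2) nz c d by (auto simp: abs_mult)
    qed
  next
    fix G :: "'a \<Rightarrow> 'a \<Rightarrow> int" and i k q
    let ?G = "G(i := \<lambda>l. G i l + q * G k l)"
    assume ik: "i \<in> insert j S" "k \<in> insert j S" "i \<noteq> k" and P: "?P ?G"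
    have "?d ?G = det_on (insert j S)
        ((\<lambda>i j. real_of_int (G i j))(i := \<lambda>l. of_int (G i l) + of_int q * of_int (G k l)))"
      by (rule arg_cong[where f="det_on _"]) auto
    also have "\<dots> = ?d G" using insert(1) ik by (intro det_on_row_add) auto
    finally have d: "?d ?G = ?d G" .
    show "?P G"
    proof (intro allI impI)
      fix c :: "'a \<Rightarrow> complex" assume nz: "?d G \<noteq> 0" and c: "\<forall>i\<in>insert j S. c i \<noteq> 0"
      let ?c = "c(i := c i * c k powi q)"
      have "\<forall>i\<in>insert j S. ?c i \<noteq> 0" using c ik by auto
      with P nz d have "finite (monomial_sols (insert j S) ?G ?c) \<and>
          real (card (monomial_sols (insert j S) ?G ?c)) = \<bar>?d ?G\<bar>" by presburger
      then show "finite (monomial_sols (insert j S) G c) \<and>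
          real (card (monomial_sols (insert j S) G c)) = \<bar>?d G\<bar>"
        using monomial_sols_row_add[of "insert j S" i k c G q] insert(1) ik c d by simp
    qed
  qed (use insert in auto)
  with insert.prems show ?case by blast
qed

section \<open>Strings of roots of unity\<close>

lemma card_inj_PiE:
  assumes "finite S" "finite R" "card S \<le> card R"
  shows "real (card {f \<in> S \<rightarrow>\<^sub>E R. inj_on f S}) = fact (card R) / fact (card R - card S)"
  using assms
proof (induction S arbitrary: R rule: finite_induct)
  case empty
  then show ?case by simp
next
  case (insert x S)
  let ?A = "{(y, g). y \<in> R \<and> g \<in> S \<rightarrow>\<^sub>E (R - {y}) \<and> inj_on g S}"
  have A: "?A = (SIGMA y:R. {g \<in> S \<rightarrow>\<^sub>E (R - {y}). inj_on g S})" by auto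
  have fin: "finite {g \<in> S \<rightarrow>\<^sub>E (R - {y}). inj_on g S}" for y
    using insert by (intro finite_subset[OF _ finite_PiE[of S "\<lambda>_. R - {y}"]]) auto
  have card: "card R \<ge> 1" "card R - 1 - card S = card R - card (insert x S)" using insert by auto
  have "card {f \<in> insert x S \<rightarrow>\<^sub>E R. inj_on f (insert x S)} = card ?A"
    using extensional_funcset_extend_domain_inj_on_eq[OF insert(2), of R]
      card_image[OF extensional_funcset_extend_domain_inj_onI[OF insert(2), of R]] by simp
  also have "real (card ?A) = (\<Sum>y\<in>R. real (card {g \<in> S \<rightarrow>\<^sub>E (R - {y}). inj_on g S}))"
    unfolding A using insert fin by (subst card_SigmaI) auto
  also have "\<dots> = (\<Sum>y\<in>R. fact (card R - 1) / fact (card R - card (insert x S)))"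
  proof (rule sum.cong[OF refl])
    fix y assume "y \<in> R"
    then have "card (R - {y}) = card R - 1" using insert by simp
    then show "real (card {g \<in> S \<rightarrow>\<^sub>E (R - {y}). inj_on g S}) =
        fact (card R - 1) / fact (card R - card (insert x S))"
      using insert.IH[of "R - {y}"] insert card by auto
  qed
  also have "\<dots> = fact (card R) / fact (card R - card (insert x S))"
    using card(1) by (simp add: fact_reduce[of "card R"])
  finally show ?case .
qed

text \<open>The counting argument detached from the Lie data: \<open>p\<close>, \<open>n\<close>,
  \<open>B\<close> and \<open>s\<close> stand for P, N, the couplings of two strings and the
  right-hand sides. The type of \<open>p\<close> encodes that P is a nonnegative integer.\<close>

locale string_system =
  fixes I :: "(nat \<times> nat) set" and n p :: "nat \<times> nat \<Rightarrow> nat"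
    and B :: "nat \<times> nat \<Rightarrow> nat \<times> nat \<Rightarrow> int" and s :: "nat \<times> nat \<Rightarrow> complex"
  assumes fin: "finite I"
    and n_pos: "\<And>i. i \<in> I \<Longrightarrow> n i > 0"
    and s_nz: "\<And>i. i \<in> I \<Longrightarrow> s i \<noteq> 0"
begin

definition T :: "(nat \<times> nat \<times> nat) set" where
  "T = {(a, m, \<alpha>). (a, m) \<in> I \<and> 1 \<le> \<alpha> \<and> \<alpha> \<le> n (a, m)}"

definition E :: "nat \<times> nat \<times> nat \<Rightarrow> nat \<times> nat \<times> nat \<Rightarrow> int" where
  "E = (\<lambda>(a, m, \<alpha>) (b, k, \<beta>). (if a = b \<and> m = k \<and> \<alpha> = \<beta> then int (p (a, m) + n (a, m)) else 0)
     + B (a, m) (b, k) - (if a = b \<and> m = k then 1 else 0))"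

text \<open>The sum of a row of \<open>E\<close> over the \<open>n j\<close> positions of string
  \<open>j\<close>; it is the same for all rows of string \<open>i\<close>.\<close>

definition F :: "nat \<times> nat \<Rightarrow> nat \<times> nat \<Rightarrow> int" where
  "F i j = (if i = j then int (p i) else 0) + B i j * int (n j)"

definition sols :: "(nat \<times> nat \<times> nat \<Rightarrow> complex) set" where
  "sols = {z \<in> T \<rightarrow>\<^sub>E (UNIV - {0}). \<forall>(a, m, \<alpha>) \<in> T. (\<Prod>j\<in>T. z j powi E (a, m, \<alpha>) j) = s (a, m)}"

text \<open>The possible ratios of the entries 2, ..., \<open>n i\<close> to the first entry. The
  root 1 is removed because the first entry has ratio 1 to itself, so \<open>n i - 1\<close>
  positions compete for \<open>p i + n i - 1\<close> roots.\<close>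

definition unity_tuples :: "nat \<times> nat \<Rightarrow> (nat \<Rightarrow> complex) set" where
  "unity_tuples i = {\<rho> \<in> {2..n i} \<rightarrow>\<^sub>E ({x. x ^ (p i + n i) = 1} - {1}). inj_on \<rho> {2..n i}}"

definition ratio :: "(nat \<times> nat \<Rightarrow> nat \<Rightarrow> complex) \<Rightarrow> nat \<times> nat \<Rightarrow> nat \<Rightarrow> complex" where
  "ratio \<rho> i \<alpha> = (if \<alpha> = 1 then 1 else \<rho> i \<alpha>)"

text \<open>The part of \<open>E\<close> that sees only the two strings and not the positions in
  them.\<close>

definition Bd :: "nat \<times> nat \<Rightarrow> nat \<times> nat \<Rightarrow> int" where
  "Bd i j = B i j - (if i = j then 1 else 0)"

text \<open>What the ratios contribute to every equation of string \<open>i\<close>; dividing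
  \<open>s i\<close> by it leaves a system for the first entries alone.\<close>

definition twist :: "(nat \<times> nat \<Rightarrow> nat \<Rightarrow> complex) \<Rightarrow> nat \<times> nat \<Rightarrow> complex" where
  "twist \<rho> i = (\<Prod>j\<in>I. (\<Prod>\<beta>=1..n j. ratio \<rho> j \<beta>) powi Bd i j)"

definition assemble :: "(nat \<times> nat \<Rightarrow> nat \<Rightarrow> complex) \<times> (nat \<times> nat \<Rightarrow> complex) \<Rightarrow> nat \<times> nat \<times> nat \<Rightarrow> complex" where
  "assemble = (\<lambda>(\<rho>, w). \<lambda>(a, m, \<alpha>)\<in>T. w (a, m) * ratio \<rho> (a, m) \<alpha>)"

lemma prod_T: "(\<Prod>j\<in>T. g j) = (\<Prod>i\<in>I. \<Prod>\<alpha>=1..n i. g (fst i, snd i, \<alpha>))"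
proof -
  have "bij_betw (\<lambda>(i, \<alpha>). (fst i, snd i, \<alpha>)) (SIGMA i:I. {1..n i}) T"
    by (rule bij_betw_byWitness[where f' = "\<lambda>(a, m, \<alpha>). ((a, m), \<alpha>)"]) (auto simp: T_def)
  from prod.reindex_bij_betw[OF this, of g] show ?thesis
    using fin by (simp add: prod.Sigma case_prod_unfold)
qed

text \<open>Isolates the one factor that depends on \<alpha>; everything else is common to all
  equations of the string, so that two of them can be divided by each other.\<close>

lemma prod_powi_E:
  assumes z: "\<And>j. j \<in> T \<Longrightarrow> z j \<noteq> (0::complex)" and i: "(a, m, \<alpha>) \<in> T"
  shows "(\<Prod>j\<in>T. z j powi E (a, m, \<alpha>) j) =
    z (a, m, \<alpha>) ^ (p (a, m) + n (a, m)) * (\<Prod>j\<in>I. (\<Prod>\<beta>=1..n j. z (fst j, snd j, \<beta>)) powi Bd (a, m) j)"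
proof -
  have "finite T"
    using fin finite_subset[of T "(\<lambda>(i, \<alpha>). (fst i, snd i, \<alpha>)) ` (SIGMA i:I. {1..n i})"]
    by (force simp: T_def)
  have "(\<Prod>j\<in>T. z j powi E (a, m, \<alpha>) j) =
      (\<Prod>j\<in>T. (if j = (a, m, \<alpha>) then z j ^ (p (a, m) + n (a, m)) else 1) * z j powi Bd (a, m) (fst j, fst (snd j)))"
  proof (rule prod.cong[OF refl])
    fix j assume "j \<in> T"
    then have "z j \<noteq> 0" by (rule z)
    moreover have "E (a, m, \<alpha>) j = (if j = (a, m, \<alpha>) then int (p (a, m) + n (a, m)) else 0) + Bd (a, m) (fst j, fst (snd j))"
      by (auto simp: E_def Bd_def split: prod.splits)
    ultimately show "z j powi E (a, m, \<alpha>) j =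
      (if j = (a, m, \<alpha>) then z j ^ (p (a, m) + n (a, m)) else 1) * z j powi Bd (a, m) (fst j, fst (snd j))"
      by (simp add: power_int_add flip: power_int_of_nat of_nat_add)
  qed
  also have "\<dots> = z (a, m, \<alpha>) ^ (p (a, m) + n (a, m)) * (\<Prod>j\<in>T. z j powi Bd (a, m) (fst j, fst (snd j)))"
    using \<open>finite T\<close> i by (simp add: prod.distrib prod.delta)
  also have "(\<Prod>j\<in>T. z j powi Bd (a, m) (fst j, fst (snd j))) =
      (\<Prod>j\<in>I. (\<Prod>\<beta>=1..n j. z (fst j, snd j, \<beta>)) powi Bd (a, m) j)"
    unfolding prod_T by (simp add: prod_powi)
  finally show ?thesis .
qed

lemma card_unity_tuples:
  assumes "i \<in> I"
  shows "finite (unity_tuples i) \<and> real (card (unity_tuples i)) = fact (p i + n i - 1) / fact (p i)"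
proof -
  let ?R = "{x::complex. x ^ (p i + n i) = 1}"
  have R: "finite ?R" "card ?R = p i + n i" "1 \<in> ?R"
    using n_pos[OF assms] finite_nth_roots[of "p i + n i" 1] card_nth_roots[of 1 "p i + n i"] by auto
  then have c: "card (?R - {1}) = p i + n i - 1" by simp
  have "real (card (unity_tuples i)) = fact (card (?R - {1})) / fact (card (?R - {1}) - card {2..n i})"
    unfolding unity_tuples_def using R c n_pos[OF assms]
    by (intro card_inj_PiE) auto
  moreover have "finite (unity_tuples i)"
    unfolding unity_tuples_def using R by (intro finite_subset[OF _ finite_PiE[of "{2..n i}" "\<lambda>_. ?R - {1}"]]) auto
  ultimately show ?thesis using c n_pos[OF assms] by simp
qed

lemma ratio_props:
  assumes "\<rho> \<in> Pi\<^sub>E I unity_tuples" "i \<in> I"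
  shows "\<alpha> \<in> {1..n i} \<Longrightarrow> ratio \<rho> i \<alpha> ^ (p i + n i) = 1"
    and "\<alpha> \<in> {1..n i} \<Longrightarrow> ratio \<rho> i \<alpha> \<noteq> 0"
    and "inj_on (ratio \<rho> i) {1..n i}"
proof -
  have \<rho>: "\<rho> i \<in> unity_tuples i" using assms by auto
  show pow: "ratio \<rho> i \<alpha> ^ (p i + n i) = 1" if "\<alpha> \<in> {1..n i}" for \<alpha>
    using \<rho> that by (force simp: ratio_def unity_tuples_def)
  show "ratio \<rho> i \<alpha> \<noteq> 0" if "\<alpha> \<in> {1..n i}" for \<alpha>
    using pow[OF that] n_pos[OF assms(2)] by (auto simp: power_0_left)
  have ne1: "\<rho> i \<alpha> \<noteq> 1" if "\<alpha> \<in> {2..n i}" for \<alpha>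
    using \<rho> that by (force simp: unity_tuples_def)
  have inj: "\<rho> i \<alpha> = \<rho> i \<beta> \<Longrightarrow> \<alpha> = \<beta>" if "\<alpha> \<in> {2..n i}" "\<beta> \<in> {2..n i}" for \<alpha> \<beta>
    using \<rho> that by (auto simp: unity_tuples_def inj_on_def)
  show "inj_on (ratio \<rho> i) {1..n i}"
  proof (rule inj_onI)
    fix \<alpha> \<beta> assume "\<alpha> \<in> {1..n i}" "\<beta> \<in> {1..n i}" "ratio \<rho> i \<alpha> = ratio \<rho> i \<beta>"
    then show "\<alpha> = \<beta>"
      using ne1[of \<alpha>] ne1[of \<beta>] inj[of \<alpha> \<beta>] by (auto simp: ratio_def split: if_splits)
  qed
qed

lemma twist_nz: "\<rho> \<in> Pi\<^sub>E I unity_tuples \<Longrightarrow> twist \<rho> i \<noteq> 0"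
  unfolding twist_def using fin ratio_props(2) by (force simp: prod_zero_iff)

lemma assemble_apply: "(a, m, \<alpha>) \<in> T \<Longrightarrow> assemble (\<rho>, w) (a, m, \<alpha>) = w (a, m) * ratio \<rho> (a, m) \<alpha>"
  by (simp add: assemble_def)

text \<open>The ratio of position \<alpha> disappears from the isolated power because it is a root
  of unity of exactly that order. Hence all equations of a string become one and the same equation
  in \<open>w\<close>.\<close>

lemma assemble_equation:
  assumes \<rho>: "\<rho> \<in> Pi\<^sub>E I unity_tuples" and w: "\<And>i. i \<in> I \<Longrightarrow> w i \<noteq> 0" and i: "(a, m, \<alpha>) \<in> T"
  shows "(\<Prod>j\<in>T. assemble (\<rho>, w) j powi E (a, m, \<alpha>) j) =
    (\<Prod>j\<in>I. w j powi F (a, m) j) * twist \<rho> (a, m)"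
proof -
  let ?z = "assemble (\<rho>, w)" and ?i = "(a, m)"
  have iI: "?i \<in> I" and \<alpha>: "\<alpha> \<in> {1..n ?i}" using i by (auto simp: T_def)
  have nz: "?z j \<noteq> 0" if "j \<in> T" for j
    using that ratio_props(2)[OF \<rho>] w by (cases j) (auto simp: assemble_apply T_def)
  have inner: "(\<Prod>\<beta>=1..n j. ?z (fst j, snd j, \<beta>)) = w j ^ n j * (\<Prod>\<beta>=1..n j. ratio \<rho> j \<beta>)" if "j \<in> I" for j
  proof -
    have "(\<Prod>\<beta>=1..n j. ?z (fst j, snd j, \<beta>)) = (\<Prod>\<beta>=1..n j. w j * ratio \<rho> j \<beta>)"
      using that by (intro prod.cong refl) (subst assemble_apply, auto simp: T_def)
    then show ?thesis by (simp add: prod.distrib)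
  qed
  have "(\<Prod>j\<in>I. w j powi F ?i j) =
      (\<Prod>j\<in>I. (if j = ?i then w j ^ (p ?i + n ?i) else 1) * (w j ^ n j) powi Bd ?i j)"
  proof (rule prod.cong[OF refl])
    fix j assume "j \<in> I"
    have "F ?i j = (if j = ?i then int (p ?i + n ?i) else 0) + int (n j) * Bd ?i j"
      by (auto simp: F_def Bd_def algebra_simps)
    moreover have "w j powi (int (n j) * Bd ?i j) = (w j ^ n j) powi Bd ?i j"
      by (simp add: power_int_mult)
    ultimately show "w j powi F ?i j = (if j = ?i then w j ^ (p ?i + n ?i) else 1) * (w j ^ n j) powi Bd ?i j"
      using w[OF \<open>j \<in> I\<close>] by (simp add: power_int_add flip: power_int_of_nat of_nat_add)
  qed
  also have "\<dots> = w ?i ^ (p ?i + n ?i) * (\<Prod>j\<in>I. (w j ^ n j) powi Bd ?i j)"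
    using fin iI by (simp add: prod.distrib prod.delta)
  finally have F: "(\<Prod>j\<in>I. w j powi F ?i j) = w ?i ^ (p ?i + n ?i) * (\<Prod>j\<in>I. (w j ^ n j) powi Bd ?i j)" .
  have "(\<Prod>j\<in>I. (\<Prod>\<beta>=1..n j. ?z (fst j, snd j, \<beta>)) powi Bd ?i j) =
      (\<Prod>j\<in>I. (w j ^ n j) powi Bd ?i j) * twist \<rho> ?i"
    by (simp only: inner twist_def power_int_mult_distrib prod.distrib cong: prod.cong)
  moreover have "?z (a, m, \<alpha>) ^ (p ?i + n ?i) = w ?i ^ (p ?i + n ?i)"
    using ratio_props(1)[OF \<rho> iI \<alpha>] i by (simp add: assemble_apply power_mult_distrib)
  ultimately show ?thesis
    unfolding F by (subst prod_powi_E[OF nz i]) simp_all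
qed

definition disassemble :: "(nat \<times> nat \<times> nat \<Rightarrow> complex) \<Rightarrow> (nat \<times> nat \<Rightarrow> nat \<Rightarrow> complex) \<times> (nat \<times> nat \<Rightarrow> complex)" where
  "disassemble z = (\<lambda>i\<in>I. \<lambda>\<alpha>\<in>{2..n i}. z (fst i, snd i, \<alpha>) / z (fst i, snd i, 1), \<lambda>i\<in>I. z (fst i, snd i, 1))"

lemma assemble_disassemble:
  assumes "z \<in> T \<rightarrow>\<^sub>E (UNIV - {0})"
  shows "assemble (disassemble z) = z"
proof
  fix j show "assemble (disassemble z) j = z j"
  proof (cases "j \<in> T")
    case True
    obtain a m \<alpha> where j: "j = (a, m, \<alpha>)" by (cases j)
    have "(a, m, 1) \<in> T" using True j by (auto simp: T_def)
    then have "z (a, m, 1) \<noteq> 0" using assms by blast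
    moreover have "(a, m) \<in> I" "1 \<le> \<alpha>" "\<alpha> \<le> n (a, m)" using True j by (auto simp: T_def)
    ultimately show ?thesis
      using True j by (auto simp: assemble_apply disassemble_def ratio_def)
  next
    case False
    then have "z j = undefined" using PiE_arb[OF assms] by blast
    then show ?thesis using False by (simp add: assemble_def disassemble_def)
  qed
qed

lemma disassemble_assemble:
  assumes \<rho>: "\<rho> \<in> Pi\<^sub>E I unity_tuples" and w: "w \<in> I \<rightarrow>\<^sub>E (UNIV - {0})"
  shows "disassemble (assemble (\<rho>, w)) = (\<rho>, w)"
proof -
  have mem: "(fst i, snd i, \<alpha>) \<in> T \<longleftrightarrow> 1 \<le> \<alpha> \<and> \<alpha> \<le> n i" if "i \<in> I" for i \<alpha>
    using that by (auto simp: T_def)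
  have one: "assemble (\<rho>, w) (fst i, snd i, Suc 0) = w i" if "i \<in> I" for i
    using that n_pos[OF that] by (subst assemble_apply) (auto simp: mem ratio_def)
  have "(\<lambda>i\<in>I. assemble (\<rho>, w) (fst i, snd i, 1)) = w"
    using w by (intro ext) (auto simp: one restrict_def PiE_def extensional_def)
  moreover have "(\<lambda>i\<in>I. \<lambda>\<alpha>\<in>{2..n i}. assemble (\<rho>, w) (fst i, snd i, \<alpha>) / assemble (\<rho>, w) (fst i, snd i, 1)) i \<alpha> = \<rho> i \<alpha>" for i \<alpha>
  proof (cases "i \<in> I")
    case True
    then have "\<rho> i \<in> unity_tuples i" "w i \<noteq> 0" using \<rho> w by auto
    then show ?thesis
      using True one[OF True]
      by (cases "\<alpha> \<in> {2..n i}") (auto simp: assemble_apply mem ratio_def unity_tuples_def PiE_def extensional_def)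
  next
    case False
    then show ?thesis using PiE_arb[OF \<rho>] by simp
  qed
  ultimately show ?thesis by (simp add: disassemble_def fun_eq_iff)
qed

lemma assemble_sols:
  assumes \<rho>: "\<rho> \<in> Pi\<^sub>E I unity_tuples" and w: "w \<in> monomial_sols I F (\<lambda>i. s i / twist \<rho> i)"
  shows "assemble (\<rho>, w) \<in> sols" "off_diagonal T (assemble (\<rho>, w))"
proof -
  have w0: "w i \<noteq> 0" if "i \<in> I" for i using w that by (auto simp: monomial_sols_def)
  have "assemble (\<rho>, w) \<in> T \<rightarrow>\<^sub>E (UNIV - {0})"
  proof (intro PiE_I)
    fix j assume "j \<in> T"
    then show "assemble (\<rho>, w) j \<in> UNIV - {0}"
      using w0 ratio_props(2)[OF \<rho>] by (cases j) (auto simp: assemble_apply T_def)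
  qed (simp add: assemble_def)
  moreover have "(\<Prod>j\<in>T. assemble (\<rho>, w) j powi E (a, m, \<alpha>) j) = s (a, m)" if "(a, m, \<alpha>) \<in> T" for a m \<alpha>
  proof -
    have "(a, m) \<in> I" using that by (simp add: T_def)
    then show ?thesis
      using assemble_equation[OF \<rho> w0 that] w twist_nz[OF \<rho>] by (simp add: monomial_sols_def)
  qed
  ultimately show "assemble (\<rho>, w) \<in> sols" by (auto simp: sols_def)
  show "off_diagonal T (assemble (\<rho>, w))"
    unfolding off_diagonal_def
  proof (intro allI impI)
    fix a m \<alpha> \<beta>
    assume T: "(a, m, \<alpha>) \<in> T" "(a, m, \<beta>) \<in> T" and eq: "assemble (\<rho>, w) (a, m, \<alpha>) = assemble (\<rho>, w) (a, m, \<beta>)"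
    then have i: "(a, m) \<in> I" "\<alpha> \<in> {1..n (a, m)}" "\<beta> \<in> {1..n (a, m)}" by (auto simp: T_def)
    have "ratio \<rho> (a, m) \<alpha> = ratio \<rho> (a, m) \<beta>"
      using eq w0[OF i(1)] T by (simp add: assemble_apply)
    then show "\<alpha> = \<beta>" using ratio_props(3)[OF \<rho> i(1)] i by (auto dest: inj_onD)
  qed
qed

lemma disassemble_sols:
  assumes z: "z \<in> sols" and off: "off_diagonal T z"
  shows "disassemble z \<in> (SIGMA \<rho>:Pi\<^sub>E I unity_tuples. monomial_sols I F (\<lambda>i. s i / twist \<rho> i))"
proof -
  obtain \<rho> w where \<rho>w: "disassemble z = (\<rho>, w)" by fastforce
  have zT: "z \<in> T \<rightarrow>\<^sub>E (UNIV - {0})" using z by (simp add: sols_def)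
  then have nz: "z j \<noteq> 0" if "j \<in> T" for j using that by blast
  have eqs: "(\<Prod>j\<in>T. z j powi E (a, m, \<alpha>) j) = s (a, m)" if "(a, m, \<alpha>) \<in> T" for a m \<alpha>
    using z that by (auto simp: sols_def)
  have \<rho>: "\<rho> \<in> Pi\<^sub>E I unity_tuples"
  proof
    fix i assume i: "i \<in> I"
    obtain a m where am: "i = (a, m)" by (cases i)
    have T: "(a, m, \<alpha>) \<in> T \<longleftrightarrow> 1 \<le> \<alpha> \<and> \<alpha> \<le> n i" for \<alpha> using i am by (simp add: T_def)
    have T1: "(a, m, 1) \<in> T" using n_pos[OF i] by (simp add: T)
    have z1: "z (a, m, 1) \<noteq> 0" using nz T1 by blast
    have \<rho>i: "\<rho> i = (\<lambda>\<alpha>\<in>{2..n i}. z (a, m, \<alpha>) / z (a, m, 1))"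
      using \<rho>w i am by (auto simp: disassemble_def)
    have pow: "(z (a, m, \<alpha>) / z (a, m, 1)) ^ (p i + n i) = 1" if \<alpha>: "(a, m, \<alpha>) \<in> T" for \<alpha>
    proof -
      let ?c = "\<Prod>j\<in>I. (\<Prod>\<beta>=1..n j. z (fst j, snd j, \<beta>)) powi Bd (a, m) j"
      \<comment> \<open>Equations \<alpha> and 1 have the same right-hand side and share
        \<open>?c\<close>, which is nonzero because it is a factor of \<open>s i\<close>; cancelling
        it makes the ratio a root of unity.\<close>
      have "z (a, m, \<alpha>) ^ (p i + n i) * ?c = z (a, m, 1) ^ (p i + n i) * ?c"
        using eqs[OF \<alpha>] eqs[OF T1] prod_powi_E[OF nz \<alpha>] prod_powi_E[OF nz T1] am by simp
      moreover have "s i \<noteq> 0" using s_nz i .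
      then have "?c \<noteq> 0" using eqs[OF \<alpha>] prod_powi_E[OF nz \<alpha>] am by auto
      ultimately show ?thesis using z1 by (simp add: power_divide)
    qed
    have dist: "\<alpha> = \<beta>" if "(a, m, \<alpha>) \<in> T" "(a, m, \<beta>) \<in> T" "z (a, m, \<alpha>) = z (a, m, \<beta>)" for \<alpha> \<beta>
      using off that unfolding off_diagonal_def by blast
    show "\<rho> i \<in> unity_tuples i"
      unfolding unity_tuples_def
    proof (intro CollectI conjI)
      show "\<rho> i \<in> {2..n i} \<rightarrow>\<^sub>E ({x. x ^ (p i + n i) = 1} - {1})"
      proof
        fix \<alpha> assume \<alpha>: "\<alpha> \<in> {2..n i}"
        then have \<alpha>T: "(a, m, \<alpha>) \<in> T" by (simp add: T)
        have "z (a, m, \<alpha>) \<noteq> z (a, m, 1)" using dist[OF \<alpha>T T1] \<alpha> by auto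
        then show "\<rho> i \<alpha> \<in> {x. x ^ (p i + n i) = 1} - {1}"
          using pow[OF \<alpha>T] \<alpha> z1 by (simp add: \<rho>i)
      qed (auto simp: \<rho>i)
      show "inj_on (\<rho> i) {2..n i}"
        using z1 by (intro inj_onI dist) (auto simp: \<rho>i T)
    qed
  next
    fix i assume "i \<notin> I"
    then show "\<rho> i = undefined" using \<rho>w by (auto simp: disassemble_def)
  qed
  have wI: "w \<in> I \<rightarrow>\<^sub>E (UNIV - {0})"
    using \<rho>w nz n_pos by (force simp: disassemble_def T_def)
  have "(\<Prod>j\<in>I. w j powi F i j) = s i / twist \<rho> i" if "i \<in> I" for i
  proof -
    obtain a m where am: "i = (a, m)" by (cases i)
    have T1: "(a, m, 1) \<in> T" using that am n_pos[OF that] by (simp add: T_def)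
    have w0: "w l \<noteq> 0" if "l \<in> I" for l using PiE_mem[OF wI that] by simp
    from assemble_equation[of \<rho> w a m 1, OF \<rho> w0 T1] show ?thesis
      using assemble_disassemble[OF zT] \<rho>w eqs[OF T1] twist_nz[OF \<rho>, of i] am by (simp add: field_simps)
  qed
  then show ?thesis using \<rho>w \<rho> wI by (simp add: monomial_sols_def)
qed

lemma bij_betw_assemble:
  "bij_betw assemble (SIGMA \<rho>:Pi\<^sub>E I unity_tuples. monomial_sols I F (\<lambda>i. s i / twist \<rho> i))
     {z \<in> sols. off_diagonal T z}"
proof (rule bij_betw_byWitness[where f' = disassemble])
  show "\<forall>x\<in>SIGMA \<rho>:Pi\<^sub>E I unity_tuples. monomial_sols I F (\<lambda>i. s i / twist \<rho> i). disassemble (assemble x) = x"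
    using disassemble_assemble by (auto simp: monomial_sols_def)
  show "\<forall>z\<in>{z \<in> sols. off_diagonal T z}. assemble (disassemble z) = z"
    using assemble_disassemble by (auto simp: sols_def)
  show "assemble ` (SIGMA \<rho>:Pi\<^sub>E I unity_tuples. monomial_sols I F (\<lambda>i. s i / twist \<rho> i))
      \<subseteq> {z \<in> sols. off_diagonal T z}"
    using assemble_sols by (simp add: image_subset_iff)
  show "disassemble ` {z \<in> sols. off_diagonal T z}
      \<subseteq> (SIGMA \<rho>:Pi\<^sub>E I unity_tuples. monomial_sols I F (\<lambda>i. s i / twist \<rho> i))"
    using disassemble_sols by (simp only: image_subset_iff mem_Collect_eq Ball_def) simp
qed

text \<open>The system for \<open>w\<close> varies with \<open>\<rho>\<close> through
  \<open>twist\<close>, but all fibres have the same size, so the cardinality of the dependent sum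
  is a product.\<close>

lemma card_off_diagonal_sols:
  assumes "det_on I (\<lambda>i j. of_int (F i j)) \<noteq> 0"
  shows "finite {z \<in> sols. off_diagonal T z} \<and>
    real (card {z \<in> sols. off_diagonal T z}) =
      \<bar>det_on I (\<lambda>i j. of_int (F i j))\<bar> * (\<Prod>i\<in>I. fact (p i + n i - 1) / fact (p i))"
proof -
  let ?\<Delta> = "\<bar>det_on I (\<lambda>i j. real_of_int (F i j))\<bar>"
  let ?D = "SIGMA \<rho>:Pi\<^sub>E I unity_tuples. monomial_sols I F (\<lambda>i. s i / twist \<rho> i)"
  have mono: "finite (monomial_sols I F (\<lambda>i. s i / twist \<rho> i)) \<and>
      real (card (monomial_sols I F (\<lambda>i. s i / twist \<rho> i))) = ?\<Delta>" if "\<rho> \<in> Pi\<^sub>E I unity_tuples" for \<rho>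
    using fin assms s_nz twist_nz[OF that] by (intro card_monomial_sols) auto
  have finP: "finite (Pi\<^sub>E I unity_tuples)"
    using fin card_unity_tuples by (auto intro!: finite_PiE)
  have "real (card ?D) = (\<Sum>\<rho>\<in>Pi\<^sub>E I unity_tuples. ?\<Delta>)"
    using finP mono by (simp add: card_SigmaI)
  also have "\<dots> = ?\<Delta> * (\<Prod>i\<in>I. fact (p i + n i - 1) / fact (p i))"
    using fin card_unity_tuples by (simp add: card_PiE)
  finally have "real (card ?D) = ?\<Delta> * (\<Prod>i\<in>I. fact (p i + n i - 1) / fact (p i))" .
  moreover have "finite ?D" using finP mono by auto
  ultimately show ?thesis
    using bij_betw_finite[OF bij_betw_assemble] bij_betw_same_card[OF bij_betw_assemble] by simp
qed

end

section \<open>Positive definiteness\<close>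

text \<open>The M-matrix criterion. Substitute y = u x: each off-diagonal product x_a x_b is the
  mean of the two squares minus half of (x_a - x_b)^2, and the latter enters with a nonnegative sign
  because \<open>C a b\<close> is nonpositive. The squares collect to the sum of u_a x_a^2 (C
  u)_a.\<close>

lemma dominant_quadratic_pos:
  fixes C :: "nat \<Rightarrow> nat \<Rightarrow> real"
  assumes "finite K"
    and sym: "\<And>a b. a \<in> K \<Longrightarrow> b \<in> K \<Longrightarrow> C a b = C b a"
    and neg: "\<And>a b. a \<in> K \<Longrightarrow> b \<in> K \<Longrightarrow> a \<noteq> b \<Longrightarrow> C a b \<le> 0"
    and u: "\<And>a. a \<in> K \<Longrightarrow> u a > 0"
    and dom: "\<And>a. a \<in> K \<Longrightarrow> (\<Sum>b\<in>K. C a b * u b) > 0"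
    and y: "\<exists>a\<in>K. y a \<noteq> 0"
  shows "(\<Sum>a\<in>K. \<Sum>b\<in>K. C a b * (y a * y b)) > 0"
proof -
  define x where "x a = y a / u a" for a
  have yx: "y a = u a * x a" if "a \<in> K" for a using u[OF that] by (simp add: x_def)
  let ?g = "\<lambda>a b. C a b * (u a * u b) * (x a)\<^sup>2"
  have term_bound: "(?g a b + ?g b a) / 2 \<le> C a b * (y a * y b)" if "a \<in> K" "b \<in> K" for a b
  proof (cases "a = b")
    case True
    then show ?thesis using that by (simp add: yx power2_eq_square)
  next
    case False
    have "C a b * (u a * u b) * (x a - x b)\<^sup>2 \<le> 0"
      using neg[OF that False] u that by (intro mult_nonpos_nonneg) (auto simp: less_imp_le)
    then show ?thesis
      using that sym[OF that] by (simp add: yx power2_eq_square algebra_simps)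
  qed
  obtain c where c: "c \<in> K" "x c \<noteq> 0" using y u yx by (metis mult_zero_right)
  have row: "(\<Sum>b\<in>K. ?g a b) = u a * (x a)\<^sup>2 * (\<Sum>b\<in>K. C a b * u b)" for a
    by (simp add: sum_distrib_left algebra_simps)
  have "0 < (\<Sum>a\<in>K. u a * (x a)\<^sup>2 * (\<Sum>b\<in>K. C a b * u b))"
  proof (rule sum_pos2[OF \<open>finite K\<close> c(1)])
    show "0 < u c * (x c)\<^sup>2 * (\<Sum>b\<in>K. C c b * u b)" using c u dom by simp
    show "0 \<le> u a * (x a)\<^sup>2 * (\<Sum>b\<in>K. C a b * u b)" if "a \<in> K" for a
      using u[OF that] dom[OF that] by (simp add: less_imp_le)
  qed
  also have "\<dots> = (\<Sum>a\<in>K. \<Sum>b\<in>K. ?g a b)" by (simp only: row)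
  also have "\<dots> = ((\<Sum>a\<in>K. \<Sum>b\<in>K. ?g a b) + (\<Sum>a\<in>K. \<Sum>b\<in>K. ?g b a)) / 2"
    using sum.swap[of ?g K K] by simp
  also have "\<dots> = (\<Sum>a\<in>K. \<Sum>b\<in>K. (?g a b + ?g b a) / 2)"
    by (simp only: sum.distrib sum_divide_distrib[symmetric])
  also have "\<dots> \<le> (\<Sum>a\<in>K. \<Sum>b\<in>K. C a b * (y a * y b))"
    using term_bound by (intro sum_mono)
  finally show ?thesis .
qed

lemma min_eq_sum_indicators:
  assumes "p \<le> L"
  shows "real (min p q) = (\<Sum>s=1..L. of_bool (s \<le> p) * of_bool (s \<le> q))"
proof -
  have "(\<Sum>s=1..L. of_bool (s \<le> p) * of_bool (s \<le> q)) = (\<Sum>s\<in>{1..L}. if s \<in> {1..min p q} then 1 else 0 :: real)"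
    by (intro sum.cong) auto
  also have "\<dots> = real (card ({1..L} \<inter> {1..min p q}))"
    by (subst sum.inter_restrict[symmetric]) simp_all
  also have "{1..L} \<inter> {1..min p q} = {1..min p q}" using assms by auto
  finally show ?thesis by simp
qed

text \<open>Writing \<open>min p q\<close> as an integral of two indicator functions splits the form into a sum of
  forms \<open>C\<close>.\<close>
lemma min_quadratic_pos:
  fixes C :: "nat \<Rightarrow> nat \<Rightarrow> real"
  assumes I: "finite I" and K: "finite K" "g ` I \<subseteq> K"
    and inj: "inj_on (\<lambda>i. (g i, l i)) I" and lpos: "\<And>i. i \<in> I \<Longrightarrow> l i > (0::nat)"
    and C: "\<And>y. \<exists>a\<in>K. y a \<noteq> 0 \<Longrightarrow> (\<Sum>a\<in>K. \<Sum>b\<in>K. C a b * (y a * y b)) > 0"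
    and x: "\<exists>i\<in>I. x i \<noteq> 0"
  shows "(\<Sum>i\<in>I. \<Sum>j\<in>I. C (g i) (g j) * real (min (l i) (l j)) * x i * x j) > 0"
proof -
  \<comment> \<open>Layer \<open>s\<close> keeps the coordinates of length at least
    \<open>s\<close>; \<open>v s\<close> adds those that belong to the same node, so each layer is
    one value of the form \<open>C\<close>.\<close>
  define w where "w s i = of_bool (s \<le> l i) * x i" for s i
  define v where "v s a = (\<Sum>i\<in>{i \<in> I. g i = a}. w s i)" for s a
  have push: "(\<Sum>a\<in>K. f a * v s a) = (\<Sum>i\<in>I. f (g i) * w s i)" for f :: "nat \<Rightarrow> real" and s
  proof -
    have "(\<Sum>a\<in>K. f a * v s a) = (\<Sum>a\<in>K. \<Sum>i\<in>{i \<in> I. g i = a}. f (g i) * w s i)"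
      by (simp add: v_def sum_distrib_left)
    also have "\<dots> = (\<Sum>i\<in>I. f (g i) * w s i)" by (rule sum.group[OF I K])
    finally show ?thesis .
  qed
  have form: "(\<Sum>a\<in>K. \<Sum>b\<in>K. C a b * (v s a * v s b)) = (\<Sum>i\<in>I. \<Sum>j\<in>I. C (g i) (g j) * (w s i * w s j))" for s
  proof -
    have "(\<Sum>a\<in>K. \<Sum>b\<in>K. C a b * (v s a * v s b)) = (\<Sum>a\<in>K. (\<Sum>b\<in>K. C a b * v s b) * v s a)"
      by (simp add: sum_distrib_right sum_distrib_left algebra_simps)
    also have "\<dots> = (\<Sum>i\<in>I. (\<Sum>j\<in>I. C (g i) (g j) * w s j) * w s i)" by (simp only: push)
    also have "\<dots> = (\<Sum>i\<in>I. \<Sum>j\<in>I. C (g i) (g j) * (w s i * w s j))"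
      by (simp add: sum_distrib_right sum_distrib_left algebra_simps)
    finally show ?thesis .
  qed
  define L where "L = Max (l ` I)"
  have L: "l i \<le> L" if "i \<in> I" for i using I that by (simp add: L_def)
  have "(\<Sum>i\<in>I. \<Sum>j\<in>I. C (g i) (g j) * real (min (l i) (l j)) * x i * x j) =
      (\<Sum>i\<in>I. \<Sum>j\<in>I. \<Sum>s=1..L. C (g i) (g j) * (w s i * w s j))"
  proof (intro sum.cong refl)
    fix i j assume "i \<in> I" "j \<in> I"
    then show "C (g i) (g j) * real (min (l i) (l j)) * x i * x j = (\<Sum>s=1..L. C (g i) (g j) * (w s i * w s j))"
      unfolding min_eq_sum_indicators[OF L[OF \<open>i \<in> I\<close>]] w_def
      by (simp only: sum_distrib_left sum_distrib_right mult_ac)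
  qed
  also have "\<dots> = (\<Sum>i\<in>I. \<Sum>s=1..L. \<Sum>j\<in>I. C (g i) (g j) * (w s i * w s j))"
    by (intro sum.cong refl sum.swap)
  also have "\<dots> = (\<Sum>s=1..L. \<Sum>a\<in>K. \<Sum>b\<in>K. C a b * (v s a * v s b))"
    unfolding form by (rule sum.swap)
  also have "\<dots> > 0"
  proof -
    obtain i0 where i0: "i0 \<in> I" "x i0 \<noteq> 0" using x by blast
    \<comment> \<open>Some layer must be nonzero. Among the nonzero coordinates on one node take the
      longest: lengths on a node are distinct, so in the layer of that length it is the only
      contribution to its node and cannot cancel.\<close>
    define J where "J = {i \<in> I. g i = g i0 \<and> x i \<noteq> 0}"
    have "finite J" "J \<noteq> {}" using I i0 by (auto simp: J_def)
    then obtain i where i: "i \<in> J" "\<And>j. j \<in> J \<Longrightarrow> l j \<le> l i"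
      using Max_in[of "l ` J"] Max_ge[of "l ` J"] by (metis (no_types, lifting) finite_imageI image_iff image_is_empty)
    then have iI: "i \<in> I" "x i \<noteq> 0" by (auto simp: J_def)
    have "v (l i) (g i) = w (l i) i"
    proof -
      have "w (l i) j = 0" if "j \<in> {j \<in> I. g j = g i} - {i}" for j
      proof (cases "x j = 0")
        case False
        then have "j \<in> J" using that i by (auto simp: J_def)
        then have "l j \<le> l i" using i by blast
        moreover have "l j \<noteq> l i" using inj that iI by (auto dest: inj_onD)
        ultimately show ?thesis by (simp add: w_def)
      qed (simp add: w_def)
      then have "(\<Sum>j\<in>{j \<in> I. g j = g i}. w (l i) j) = (\<Sum>j\<in>{i}. w (l i) j)"
        using I iI by (intro sum.mono_neutral_right) auto
      then show ?thesis by (simp add: v_def)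
    qed
    then have v: "v (l i) (g i) \<noteq> 0" using iI by (simp add: w_def)
    have "g i \<in> K" using K iI by auto
    show ?thesis
    proof (rule sum_pos2)
      show "l i \<in> {1..L}" using lpos[OF iI(1)] L[OF iI(1)] by simp
      show "0 < (\<Sum>a\<in>K. \<Sum>b\<in>K. C a b * (v (l i) a * v (l i) b))"
        using C v \<open>g i \<in> K\<close> by blast
      show "0 \<le> (\<Sum>a\<in>K. \<Sum>b\<in>K. C a b * (v s a * v s b))" for s
      proof (cases "\<exists>a\<in>K. v s a \<noteq> 0")
        case True
        then show ?thesis using C[of "v s"] by linarith
      qed simp
    qed simp
  qed
  finally show ?thesis .
qed

section \<open>Cartan matrices\<close>

text \<open>Makes \<open>cartan0 t b a / (eps t b * dprime t a)\<close> symmetric after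
  multiplication by the weight of \<open>b\<close>. In the untwisted types the division by d'
  already does so, and for A^(2)_{2n} \<open>eps\<close> halves the entry -2; in the other twisted
  types d' is 1 and the weights are the d_a of g_0.\<close>

fun symmetrizer :: "afftype \<Rightarrow> nat \<Rightarrow> int" where
  "symmetrizer (A2odd n) a = (if a = n then 2 else 1)"
| "symmetrizer (D2 n) a = (if a = n then 1 else 2)"
| "symmetrizer E62 a = (if a \<le> 2 then 2 else 1)"
| "symmetrizer D43 a = (if a = 2 then 3 else 1)"
| "symmetrizer t a = 1"

text \<open>A parabola with second difference -2, zero at 0 and apex at \<open>n\<close>. The last
  step up is still 1, which keeps the final row of B positive: it evaluates to 2 h(n) - 2 h(n -
  1).\<close>

definition concave :: "nat \<Rightarrow> nat \<Rightarrow> int" where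
  "concave n a = int a * (2 * int n - int a)"

definition concave_C :: "nat \<Rightarrow> nat \<Rightarrow> int" where
  "concave_C n a = (if a = n then concave n a else 2 * concave n a)"

text \<open>This is \<open>concave_C\<close> of rank \<open>n - 1\<close> with its last value given
  to both fork ends: node n - 2 meets them with two entries -1, which add up to the -2 of C.\<close>

definition concave_D :: "nat \<Rightarrow> nat \<Rightarrow> int" where
  "concave_D n a = (if n \<le> a + 1 then concave (n - 1) (n - 1) else 2 * concave (n - 1) a)"

text \<open>The numerical entries solve \<open>A h = (2, \<dots>, 2)\<close>; for the infinite families an increasing
  strictly concave sequence will do, halved at the end node of \<open>C\<close> and at the fork ends of \<open>D\<close>.\<close>
fun positive_vector :: "afftype \<Rightarrow> nat \<Rightarrow> int" where
  "positive_vector (A1 n) a = concave n a"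
| "positive_vector (B1 n) a = concave n a"
| "positive_vector (C1 n) a = concave_C n a"
| "positive_vector (D1 n) a = concave_D n a"
| "positive_vector (E1 n) a =
    (if n = 6 then [16, 22, 30, 42, 30, 16] ! (a - 1)
     else if n = 7 then [34, 49, 66, 96, 75, 52, 27] ! (a - 1)
     else [92, 136, 182, 270, 220, 168, 114, 58] ! (a - 1))"
| "positive_vector F41 a = [16, 30, 42, 22] ! (a - 1)"
| "positive_vector G21 a = [10, 6] ! (a - 1)"
| "positive_vector (A2even n) a = concave n a"
| "positive_vector (A2odd n) a = concave_C n a"
| "positive_vector (D2 n) a = concave n a"
| "positive_vector E62 a = [16, 30, 42, 22] ! (a - 1)"
| "positive_vector D43 a = [10, 6] ! (a - 1)"

lemma eps_eq:
  assumes "valid_type t" "a \<in> {1..rank0 t}"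
  shows "eps t a = (case t of A2even n \<Rightarrow> if a = n then 2 else 1 | _ \<Rightarrow> 1)"
proof (cases t)
  case (A2odd n)
  \<comment> \<open>A node and its image 2n - a have the same parity, so they are never neighbours
    on the chain.\<close>
  then have "a + 1 \<noteq> 2 * n - a" "2 * n - a + 1 \<noteq> a" using assms by simp_all presburger+
  then show ?thesis using assms A2odd by (auto simp: eps_def cartan_A_def)
next
  case (D2 n)
  then show ?thesis using assms by (auto simp: eps_def cartan_D_def doubleton_eq_iff)
next
  case E62
  then show ?thesis using assms by (auto simp: eps_def cartan_E_def e6lab_def doubleton_eq_iff)
next
  case D43
  then show ?thesis using assms by (auto simp: eps_def cartan_D_def doubleton_eq_iff)
qed (use assms in \<open>auto simp: eps_def cartan_A_def cartan_B_def cartan_C_def cartan_D_def cartan_E_def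
       cartan_F4_def cartan_G2_def\<close>)

lemma cartan0_offdiag_nonpos: "a \<noteq> b \<Longrightarrow> cartan0 t a b \<le> 0"
  by (cases t) (auto simp: cartan_A_def cartan_B_def cartan_C_def cartan_D_def cartan_E_def cartan_F4_def cartan_G2_def)

lemma symmetrizer_pos: "symmetrizer t a > 0"
  by (cases t) auto

lemma eps_pos: "eps t a > 0" and dprime_pos: "dprime t a > 0"
  by (simp add: eps_def) (cases t; simp)

lemma cartan_sym:
  "cartan_D r i j = cartan_D r j i" "cartan_E r i j = cartan_E r j i"
  unfolding cartan_D_def cartan_E_def by (auto simp: insert_commute[of i j "{}"] max.commute)

lemma cartan0_symmetrizable:
  assumes "valid_type t" "a \<in> {1..rank0 t}" "b \<in> {1..rank0 t}"
  shows "symmetrizer t b * cartan0 t b a * int (eps t a * dprime t b) =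
    symmetrizer t a * cartan0 t a b * int (eps t b * dprime t a)"
proof (cases t)
  case (D1 n)
  then show ?thesis using assms by (simp add: eps_eq cartan_sym(1))
next
  case (E1 n)
  then show ?thesis using assms by (simp add: eps_eq cartan_sym(2))
qed (use assms in \<open>auto simp: eps_eq cartan_A_def cartan_B_def cartan_C_def cartan_F4_def cartan_G2_def\<close>)

text \<open>The two reasons why \<open>coef\<close> is an integer: either the whole denominator
  divides the Cartan entry, or \<open>eps\<close> does and \<open>dprime t b\<close> divides both
  arguments of the minimum.\<close>

lemma cartan0_dvd:
  assumes "valid_type t" "a \<in> {1..rank0 t}" "b \<in> {1..rank0 t}"
  shows "int (eps t a * dprime t b) dvd cartan0 t a b \<or>
    int (eps t a) dvd cartan0 t a b \<and> dprime t b dvd dprime t a"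
proof (cases t)
  case (D1 n)
  then show ?thesis using assms by (simp add: eps_eq)
next
  case (E1 n)
  then show ?thesis using assms by (simp add: eps_eq)
qed (use assms in \<open>auto simp: eps_eq cartan_A_def cartan_B_def cartan_C_def cartan_F4_def cartan_G2_def\<close>)

lemma coef_integral:
  assumes "valid_type t" "a \<in> {1..rank0 t}" "b \<in> {1..rank0 t}"
  shows "coef t a m b k \<in> \<int>"
  using cartan0_dvd[OF assms]
proof
  assume "int (eps t a * dprime t b) dvd cartan0 t a b"
  then obtain c where "cartan0 t a b = int (eps t a * dprime t b) * c" by (elim dvdE)
  then show ?thesis using eps_pos[of t a] dprime_pos[of t b] by (simp add: coef_def)
next
  assume *: "int (eps t a) dvd cartan0 t a b \<and> dprime t b dvd dprime t a"
  then obtain c where "cartan0 t a b = int (eps t a) * c" by (elim conjE dvdE)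
  moreover from * obtain d where "dprime t a = dprime t b * d" by (elim conjE dvdE)
  moreover have "min (x * d * m) (x * k) = x * min (d * m) k" for x :: nat
    by (simp add: min_def mult.assoc)
  ultimately show ?thesis using eps_pos[of t a] dprime_pos[of t b] by (simp add: coef_def)
qed

section \<open>Cartan matrices applied to explicit positive vectors\<close>

lemma sum_cartan_A:
  assumes "a \<in> {1..n}"
  shows "(\<Sum>b=1..n. cartan_A n a b * h b) =
    2 * h a - (if a = 1 then 0 else h (a - 1)) - (if a = n then 0 else h (a + 1))"
proof -
  \<comment> \<open>At the ends of the chain \<open>a - 1 = 0\<close> or
    \<open>a + 1 = n + 1\<close> lies outside the range of \<open>b\<close>, so the missing
    neighbour drops out by itself.\<close>
  have "(\<Sum>b=1..n. cartan_A n a b * h b) =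
      (\<Sum>b=1..n. (if b = a then 2 * h b else 0) - (if b = a - 1 then h b else 0) - (if b = a + 1 then h b else 0))"
    using assms by (intro sum.cong) (auto simp: cartan_A_def)
  then show ?thesis using assms by (simp add: sum_subtractf) auto
qed

text \<open>B has one more -1 than A, in its last row. Rank 1, which occurs for A^(2)_2, has no such
  entry; hence the condition on \<open>n\<close>.\<close>

lemma sum_cartan_B:
  assumes "a \<in> {1..n}"
  shows "(\<Sum>b=1..n. cartan_B n a b * h b) =
    (\<Sum>b=1..n. cartan_A n a b * h b) - (if a = n \<and> n \<ge> 2 then h (n - 1) else 0)"
proof -
  have "(\<Sum>b=1..n. cartan_B n a b * h b) =
      (\<Sum>b=1..n. cartan_A n a b * h b - (if b = n - 1 then if a = n then h b else 0 else 0))"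
    using assms by (intro sum.cong) (auto simp: cartan_A_def cartan_B_def)
  then show ?thesis using assms by (simp add: sum_subtractf) auto
qed

lemma sum_cartan_C:
  assumes "a \<in> {1..n}" "n \<ge> 2"
  shows "(\<Sum>b=1..n. cartan_C n a b * h b) =
    (\<Sum>b=1..n. cartan_A n a b * h b) - (if a + 1 = n then h n else 0)"
proof -
  have "(\<Sum>b=1..n. cartan_C n a b * h b) =
      (\<Sum>b=1..n. cartan_A n a b * h b - (if b = n then if a + 1 = n then h b else 0 else 0))"
    using assms by (intro sum.cong) (auto simp: cartan_A_def cartan_C_def)
  then show ?thesis using assms by (simp add: sum_subtractf)
qed

text \<open>The diagram of D is the chain with the edge {n - 1, n} moved to {n - 2, n}; as
  corrections to A this reuses the row sums of the chain.\<close>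

lemma cartan_D_alt:
  assumes "a \<in> {1..n}" "b \<in> {1..n}" "n \<ge> 4"
  shows "cartan_D n a b = cartan_A n a b
        + (if b = n \<and> a + 1 = n then 1 else 0)
        - (if b = n \<and> a + 2 = n then 1 else 0)
        + (if b + 1 = n \<and> a = n then 1 else 0)
        - (if b + 2 = n \<and> a = n then 1 else 0)"
proof -
  have "{a, b} = {n - 2, n} \<longleftrightarrow> b = n \<and> a + 2 = n \<or> a = n \<and> b + 2 = n"
    using assms by (auto simp: doubleton_eq_iff)
  moreover have "(a + 1 = b \<or> b + 1 = a) \<and> max a b \<le> n - 1 \<longleftrightarrow>
      (a + 1 = b \<or> b + 1 = a) \<and> \<not> (a + 1 = n \<and> b = n) \<and> \<not> (b + 1 = n \<and> a = n)"
    using assms by auto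
  ultimately show ?thesis using assms unfolding cartan_D_def cartan_A_def
    by (simp split: if_split)
qed

lemma sum_cartan_D:
  assumes "a \<in> {1..n}" "n \<ge> 4"
  shows "(\<Sum>b=1..n. cartan_D n a b * h b) =
    (\<Sum>b=1..n. cartan_A n a b * h b)
    + (if a + 1 = n then h n else 0) - (if a + 2 = n then h n else 0)
    + (if a = n then h (n - 1) - h (n - 2) else 0)"
proof -
  have "(\<Sum>b=1..n. cartan_D n a b * h b) =
      (\<Sum>b=1..n. cartan_A n a b * h b
        + (if b = n then if a + 1 = n then h b else 0 else 0)
        - (if b = n then if a + 2 = n then h b else 0 else 0)
        + (if b = n - 1 then if a = n then h b else 0 else 0)
        - (if b = n - 2 then if a = n then h b else 0 else 0))"
  proof (rule sum.cong[OF refl])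
    fix b assume b: "b \<in> {1..n}"
    have "b + 1 = n \<longleftrightarrow> b = n - 1" "b + 2 = n \<longleftrightarrow> b = n - 2" using assms by auto
    then show "cartan_D n a b * h b = cartan_A n a b * h b
        + (if b = n then if a + 1 = n then h b else 0 else 0)
        - (if b = n then if a + 2 = n then h b else 0 else 0)
        + (if b = n - 1 then if a = n then h b else 0 else 0)
        - (if b = n - 2 then if a = n then h b else 0 else 0)"
      unfolding cartan_D_alt[OF assms(1) b assms(2)] by (simp only: algebra_simps) simp
  qed
  also have "\<dots> = (\<Sum>b=1..n. cartan_A n a b * h b)
    + (if a + 1 = n then h n else 0) - (if a + 2 = n then h n else 0)
    + (if a = n then h (n - 1) else 0) - (if a = n then h (n - 2) else 0)"
    using assms by (simp only: sum_subtractf sum.distrib) simp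
  finally show ?thesis by simp
qed

lemma concave_diff: "n \<ge> 1 \<Longrightarrow> concave n n - concave n (n - 1) = 1"
  by (simp add: concave_def algebra_simps of_nat_diff)

lemma concave_diff2: "a \<ge> 1 \<Longrightarrow> 2 * concave n a - concave n (a - 1) - concave n (a + 1) = 2"
  by (simp add: concave_def algebra_simps of_nat_diff)

lemma concave_0: "concave n 0 = 0"
  by (simp add: concave_def)

lemma concave_pos: "1 \<le> a \<Longrightarrow> a \<le> n \<Longrightarrow> concave n a > 0"
  by (simp add: concave_def)

lemma positive_vector_pos:
  assumes "valid_type t" "a \<in> {1..rank0 t}"
  shows "positive_vector t a > 0"
proof -
  have "a = 1 \<or> a = 2 \<or> a = 3 \<or> a = 4 \<or> a = 5 \<or> a = 6 \<or> a = 7 \<or> a = 8" if "a \<le> 8"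
    using that assms by auto
  then show ?thesis
    using assms by (cases t) (auto simp: concave_C_def concave_D_def intro: concave_pos)
qed

lemma cartan_AB_dominant:
  assumes "a \<in> {1..n}"
  shows "(\<Sum>b=1..n. cartan_A n a b * concave n b) > 0" "(\<Sum>b=1..n. cartan_B n a b * concave n b) > 0"
  unfolding sum_cartan_B[OF assms] sum_cartan_A[OF assms]
  using assms concave_diff2[of a n] concave_diff[of n] concave_0[of n] concave_pos[of n n]
  by (auto split: if_splits)

lemma cartan_C_dominant:
  assumes "a \<in> {1..n}" "n \<ge> 2"
  shows "(\<Sum>b=1..n. cartan_C n a b * concave_C n b) > 0"
proof -
  obtain c where c: "a = Suc c" using assms by (cases a) auto
  show ?thesis
    unfolding sum_cartan_C[OF assms] sum_cartan_A[OF assms(1)]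
    using assms concave_diff2[of a n] concave_diff[of n] concave_0[of n]
    by (auto simp: concave_C_def c split: if_splits)
qed

lemma cartan_D_dominant:
  assumes "a \<in> {1..n}" "n \<ge> 4"
  shows "(\<Sum>b=1..n. cartan_D n a b * concave_D n b) > 0"
proof -
  obtain c where c: "a = Suc c" using assms by (cases a) auto
  obtain k where k: "n = Suc (Suc k)" using assms by (intro that[of "n - 2"]) simp
  show ?thesis
    unfolding sum_cartan_D[OF assms] sum_cartan_A[OF assms(1)]
    using assms concave_diff2[of a "n - 1"] concave_diff[of "n - 1"] concave_0[of "n - 1"]
    by (auto simp: concave_D_def c k split: if_splits)
qed

lemma atLeastAtMost_numerals:
  "{1..2::nat} = {1,2}" "{1..4::nat} = {1,2,3,4}" "{1..6::nat} = {1,2,3,4,5,6}"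
  "{1..7::nat} = {1,2,3,4,5,6,7}" "{1..8::nat} = {1,2,3,4,5,6,7,8}"
  by auto

lemma cartan_E_alt:
  "cartan_E r i j = (if i \<in> {1..r} \<and> j \<in> {1..r} then
     (if i = j then 2
      else if (i, j) \<in> {(1,3),(3,4),(4,5),(5,6),(6,7),(7,8),(2,4),(3,1),(4,3),(5,4),(6,5),(7,6),(8,7),(4,2)}
      then -1 else 0) else 0)"
  by (auto simp: cartan_E_def doubleton_eq_iff)

lemma cartan_E_dominant:
  assumes "n \<in> {6, 7, 8}" "a \<in> {1..n}"
  shows "(\<Sum>b=1..n. cartan_E n a b * positive_vector (E1 n) b) > 0"
proof -
  from assms(1) consider "n = 6" | "n = 7" | "n = 8" by auto
  then show ?thesis
  proof cases
    case 1
    then have "a \<in> {1, 2, 3, 4, 5, 6}" using assms(2) by auto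
    then show ?thesis unfolding 1 atLeastAtMost_numerals by (elim insertE emptyE) (simp_all add: cartan_E_alt)
  next
    case 2
    then have "a \<in> {1, 2, 3, 4, 5, 6, 7}" using assms(2) by auto
    then show ?thesis unfolding 2 atLeastAtMost_numerals by (elim insertE emptyE) (simp_all add: cartan_E_alt)
  next
    case 3
    then have "a \<in> {1, 2, 3, 4, 5, 6, 7, 8}" using assms(2) by auto
    then show ?thesis unfolding 3 atLeastAtMost_numerals by (elim insertE emptyE) (simp_all add: cartan_E_alt)
  qed
qed

lemma cartan_F4_dominant:
  assumes "a \<in> {1..4}"
  shows "(\<Sum>b=1..4. cartan_F4 a b * [16, 30, 42, 22] ! (b - 1)) > 0"
  using assms unfolding atLeastAtMost_numerals
  by (elim insertE emptyE) (simp_all add: cartan_F4_def cartan_A_def)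

lemma cartan_G2_dominant:
  assumes "a \<in> {1..2}"
  shows "(\<Sum>b=1..2. cartan_G2 a b * [10, 6] ! (b - 1)) > 0"
  using assms unfolding atLeastAtMost_numerals
  by (elim insertE emptyE) (simp_all add: cartan_G2_def cartan_A_def)

text \<open>The certificate of finite type, which supplies the dominance hypothesis of
  \<open>dominant_quadratic_pos\<close>.\<close>

lemma cartan0_dominant:
  assumes "valid_type t" "a \<in> {1..rank0 t}"
  shows "(\<Sum>b=1..rank0 t. cartan0 t a b * positive_vector t b) > 0"
proof (cases t)
  case (E1 n)
  then show ?thesis using assms cartan_E_dominant[of n a] by simp
qed (use assms cartan_AB_dominant cartan_C_dominant cartan_D_dominant cartan_F4_dominant cartan_G2_dominant
  in \<open>simp_all del: One_nat_def\<close>)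

section \<open>The string center equation\<close>

lemma Hprime_index: "(a, m) \<in> Hprime t N \<Longrightarrow> a \<in> {1..rank0 t} \<and> m \<ge> 1 \<and> N a m > 0"
  by (auto simp: Hprime_def Hset_def)

lemma finite_Hprime: "in_calN t N \<Longrightarrow> finite (Hprime t N)"
  unfolding in_calN_def Hprime_def by (auto elim: finite_subset[rotated])

lemma Pvac_integral:
  assumes "valid_type t" "(a, m) \<in> Hprime t N"
  shows "Pvac t \<nu> N a m \<in> \<int>"
proof -
  have "gam \<nu> a m \<in> \<int>" unfolding gam_def by (intro Ints_sum Ints_of_nat)
  moreover have "(\<Sum>(b, k)\<in>Hprime t N. coef t a m b k * real (N b k)) \<in> \<int>"
    using assms Hprime_index by (intro Ints_sum) (auto intro!: Ints_mult coef_integral)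
  ultimately show ?thesis unfolding Pvac_def by (rule Ints_diff)
qed

lemma Fmat_eq:
  "Fmat t \<nu> N (a, m) (b, k) = (if (a, m) = (b, k) then Pvac t \<nu> N a m else 0) + coef t b k a m * real (N b k)"
  by (simp add: Fmat_def coef_def min.commute)

lemma cartan_quadratic_pos:
  assumes t: "valid_type t" and y: "\<exists>a\<in>{1..rank0 t}. y a \<noteq> 0"
  shows "(\<Sum>a\<in>{1..rank0 t}. \<Sum>b\<in>{1..rank0 t}.
    real_of_int (cartan0 t b a * symmetrizer t b) / real (eps t b * dprime t a) * (y a * y b)) > 0"
\<comment> \<open>By symmetry the entry at (a, b) may be read with \<open>dprime t b\<close> in its
  denominator. The factor \<open>dprime t b\<close> of the test vector cancels it, and the row sum
  becomes a positive multiple of coordinate \<open>a\<close> of A h.\<close>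
proof (rule dominant_quadratic_pos[where u = "\<lambda>b. real (dprime t b) * real_of_int (positive_vector t b)"])
  let ?C = "\<lambda>a b. real_of_int (cartan0 t b a * symmetrizer t b) / real (eps t b * dprime t a)"
  show sym: "?C a b = ?C b a" if "a \<in> {1..rank0 t}" "b \<in> {1..rank0 t}" for a b
  proof -
    have "real_of_int (symmetrizer t b * cartan0 t b a * int (eps t a * dprime t b)) =
        real_of_int (symmetrizer t a * cartan0 t a b * int (eps t b * dprime t a))"
      using cartan0_symmetrizable[OF t that] by simp
    then show ?thesis
      using eps_pos[of t a] eps_pos[of t b] dprime_pos[of t a] dprime_pos[of t b] by (simp add: field_simps)
  qed
  show "?C a b \<le> 0" if "a \<noteq> b" for a b
    using cartan0_offdiag_nonpos[of b a t] symmetrizer_pos[of t b] that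
    by (intro divide_nonpos_nonneg) (auto simp: mult_nonpos_nonneg)
  show "real (dprime t a) * real_of_int (positive_vector t a) > 0" if "a \<in> {1..rank0 t}" for a
    using positive_vector_pos[OF t that] dprime_pos[of t a] by simp
  show "(\<Sum>b\<in>{1..rank0 t}. ?C a b * (real (dprime t b) * real_of_int (positive_vector t b))) > 0"
    if a: "a \<in> {1..rank0 t}" for a
  proof -
    have "(\<Sum>b\<in>{1..rank0 t}. ?C a b * (real (dprime t b) * real_of_int (positive_vector t b))) =
        (\<Sum>b\<in>{1..rank0 t}. real_of_int (symmetrizer t a) / real (eps t a) * real_of_int (cartan0 t a b * positive_vector t b))"
    proof (rule sum.cong[OF refl])
      fix b assume "b \<in> {1..rank0 t}"
      then show "?C a b * (real (dprime t b) * real_of_int (positive_vector t b)) =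
          real_of_int (symmetrizer t a) / real (eps t a) * real_of_int (cartan0 t a b * positive_vector t b)"
        unfolding sym[OF a \<open>b \<in> {1..rank0 t}\<close>] using dprime_pos[of t b] by simp
    qed
    also have "\<dots> = real_of_int (symmetrizer t a) / real (eps t a) *
        real_of_int (\<Sum>b=1..rank0 t. cartan0 t a b * positive_vector t b)"
      by (simp add: sum_distrib_left)
    also have "\<dots> > 0"
      using cartan0_dominant[OF t a] symmetrizer_pos[of t a] eps_pos[of t a]
      by (intro mult_pos_pos divide_pos_pos) (simp_all only: of_int_0_less_iff of_nat_0_less_iff)
    finally show ?thesis .
  qed
qed (use y in auto)

lemma det_Fmat_pos:
  assumes t: "valid_type t" and N: "in_calN t N"
    and P: "\<forall>(a, m) \<in> Hprime t N. Pvac t \<nu> N a m \<ge> 0"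
  shows "det_on (Hprime t N) (Fmat t \<nu> N) > 0"
proof -
  let ?I = "Hprime t N"
  \<comment> \<open>The weight of column (b, k) removes the factor \<open>N b k\<close> from the
    coupling and symmetrizes the Cartan entry; being positive, it does not alter the sign of the
    determinant.\<close>
  define u where "u = (\<lambda>(b, k). real_of_int (symmetrizer t b) / real (N b k))"
  define C where "C a b = real_of_int (cartan0 t b a * symmetrizer t b) / real (eps t b * dprime t a)" for a b
  define l where "l = (\<lambda>(a, m). dprime t a * m)"
  define D where "D = (\<lambda>(a, m). Pvac t \<nu> N a m * u (a, m))"
  have fin: "finite ?I" using N by (rule finite_Hprime)
  have u: "u i > 0" if "i \<in> ?I" for i
    using that symmetrizer_pos Hprime_index by (cases i) (auto simp: u_def)
  have D: "D i \<ge> 0" if "i \<in> ?I" for i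
    using that u[OF that] P by (auto simp: D_def)
  have scaled: "Fmat t \<nu> N i j * u j = (if i = j then D i else 0) + C (fst i) (fst j) * real (min (l i) (l j))"
    if "j \<in> ?I" for i j
    using Hprime_index[of "fst j" "snd j" t N] that
    by (cases i; cases j) (auto simp: Fmat_eq coef_def C_def l_def D_def u_def field_simps min.commute)
  have "det_on ?I (\<lambda>i j. Fmat t \<nu> N i j * u j) > 0"
  proof (rule det_on_pos[OF fin])
    fix x :: "nat \<times> nat \<Rightarrow> real" assume x: "\<exists>i\<in>?I. x i \<noteq> 0"
    have "(\<Sum>i\<in>?I. \<Sum>j\<in>?I. Fmat t \<nu> N i j * u j * x i * x j) =
        (\<Sum>i\<in>?I. \<Sum>j\<in>?I. (if i = j then D i * x i * x j else 0) + C (fst i) (fst j) * real (min (l i) (l j)) * x i * x j)"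
      by (intro sum.cong refl) (simp only: scaled, simp add: distrib_right)
    also have "\<dots> = (\<Sum>i\<in>?I. D i * x i * x i) +
        (\<Sum>i\<in>?I. \<Sum>j\<in>?I. C (fst i) (fst j) * real (min (l i) (l j)) * x i * x j)"
      using fin by (simp add: sum.distrib)
    also have "\<dots> > 0"
    proof (rule add_nonneg_pos)
      show "(\<Sum>i\<in>?I. D i * x i * x i) \<ge> 0" using D by (intro sum_nonneg) (simp add: mult.assoc)
      show "0 < (\<Sum>i\<in>?I. \<Sum>j\<in>?I. C (fst i) (fst j) * real (min (l i) (l j)) * x i * x j)"
      proof (rule min_quadratic_pos[where K = "{1..rank0 t}"])
        show "fst ` ?I \<subseteq> {1..rank0 t}" using Hprime_index by fastforce
        show "inj_on (\<lambda>i. (fst i, l i)) ?I"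
          using dprime_pos[of t] by (auto intro!: inj_onI simp: l_def less_imp_neq[symmetric])
        show "l i > 0" if "i \<in> ?I" for i
          using that dprime_pos[of t] Hprime_index by (cases i) (force simp: l_def)
        show "(\<Sum>a\<in>{1..rank0 t}. \<Sum>b\<in>{1..rank0 t}. C a b * (y a * y b)) > 0"
          if "\<exists>a\<in>{1..rank0 t}. y a \<noteq> 0" for y
          unfolding C_def using cartan_quadratic_pos[OF t that] .
      qed (use fin x in auto)
    qed
    finally show "0 < (\<Sum>i\<in>?I. \<Sum>j\<in>?I. Fmat t \<nu> N i j * u j * x i * x j)" .
  qed
  then have "det_on ?I (Fmat t \<nu> N) * (\<Prod>j\<in>?I. u j) > 0" by (simp only: det_on_scale_columns)
  moreover have "(\<Prod>j\<in>?I. u j) > 0" using u by (rule prod_pos)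
  ultimately show ?thesis by (simp add: zero_less_mult_iff)
qed

theorem theorem2p13:
  fixes t :: afftype and \<nu> N :: "nat \<Rightarrow> nat \<Rightarrow> nat"
  assumes "valid_type t"
    and "in_calN t \<nu>" and "in_calN t N"
    and "\<forall>(a, m) \<in> Hprime t N. Pvac t \<nu> N a m \<ge> 0"
  shows "finite (offdiag_solutions t \<nu> N) \<and>
         real (card (offdiag_solutions t \<nu> N)) / (\<Prod>(a, m) \<in> Hprime t N. fact (N a m))
           = Rnum t \<nu> N"
proof -
  let ?I = "Hprime t N"
  define n where "n = (\<lambda>(a, m). N a m)"
  \<comment> \<open>The floors here and in \<open>B\<close> are exact by
    \<open>Pvac_integral\<close> and \<open>coef_integral\<close>, and \<open>nat\<close> loses
    nothing because P is nonnegative.\<close>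
  define p where "p = (\<lambda>(a, m). nat \<lfloor>Pvac t \<nu> N a m\<rfloor>)"
  define B where "B = (\<lambda>(a, m) (b, k). \<lfloor>coef t b k a m\<rfloor>)"
  define s :: "nat \<times> nat \<Rightarrow> complex"
    where "s = (\<lambda>(a, m). (-1) powi (\<lfloor>Phat t \<nu> N a m\<rfloor> + int (N a m) + 1))"
  have P: "real (p (a, m)) = Pvac t \<nu> N a m" if "(a, m) \<in> ?I" for a m
    using Pvac_integral[OF assms(1) that, of \<nu>] assms(4) that by (auto simp: p_def elim!: Ints_cases)
  have B: "real_of_int (B (a, m) (b, k)) = coef t b k a m" if "(a, m) \<in> ?I" "(b, k) \<in> ?I" for a m b k
    using coef_integral[OF assms(1), of b a k m] Hprime_index that by (auto simp: B_def elim!: Ints_cases)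
  interpret string_system ?I n p B s
    by unfold_locales (use finite_Hprime[OF assms(3)] Hprime_index in \<open>auto simp: n_def s_def\<close>)
  have n: "n (a, m) = N a m" for a m by (simp add: n_def)
  have T: "T = Tidx t N" by (auto simp: T_def Tidx_def n)
  have E: "\<lfloor>Amat t \<nu> N i j\<rfloor> = E i j" if ij: "i \<in> Tidx t N" "j \<in> Tidx t N" for i j
  proof -
    obtain a m \<alpha> b k \<beta> where [simp]: "i = (a, m, \<alpha>)" "j = (b, k, \<beta>)" by (cases i; cases j)
    have "(a, m) \<in> ?I" "(b, k) \<in> ?I" using ij by (auto simp: Tidx_def)
    then have "Amat t \<nu> N i j = of_int (E i j)"
      using P[of a m] P[of b k] B[of a m b k] by (auto simp: Amat_def E_def n coef_def min.commute)
    then show ?thesis by simp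
  qed
  have s: "s (a, m) = (-1) powi (\<lfloor>Phat t \<nu> N a m\<rfloor> + int (N a m) + 1)" for a m by (simp add: s_def)
  have "(\<Prod>j\<in>Tidx t N. z j powi \<lfloor>Amat t \<nu> N i j\<rfloor>) = (\<Prod>j\<in>Tidx t N. z j powi E i j)"
    if "i \<in> Tidx t N" for z :: "nat \<times> nat \<times> nat \<Rightarrow> complex" and i
    using E that by (intro prod.cong) auto
  then have "sce_solutions t \<nu> N = sols"
    unfolding sce_solutions_def sols_def T
    by (intro Collect_cong conj_cong refl ball_cong) (auto simp: s split: prod.splits)
  then have sols: "offdiag_solutions t \<nu> N = {z \<in> sols. off_diagonal T z}"
    by (simp add: offdiag_solutions_def T)
  have det: "det_on ?I (\<lambda>i j. of_int (F i j)) = det_on ?I (Fmat t \<nu> N)"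
    by (rule det_on_cong) (auto simp: F_def Fmat_eq P B n split: if_splits)
  note pos = det_Fmat_pos[OF assms(1,3,4)]
  \<comment> \<open>(P + N - 1)! / P! is (N - 1)! times the binomial coefficient, and (N - 1)! = N!
    / N: this produces the factor 1/N and the N! by which the count is divided.\<close>
  have binom: "fact (p i + n i - 1) / fact (p i) = fact (n i) * (case i of (a, m) \<Rightarrow>
      1 / real (N a m) * ((Pvac t \<nu> N a m + real (N a m) - 1) gchoose (N a m - 1)))" if "i \<in> ?I" for i
  proof -
    obtain a m where i: "i = (a, m)" by (cases i)
    have N: "N a m > 0" using Hprime_index that i by blast
    have "Pvac t \<nu> N a m + real (N a m) - 1 = real (p i + N a m - 1)"
      using P that N i by (simp add: of_nat_diff)
    then have "(Pvac t \<nu> N a m + real (N a m) - 1) gchoose (N a m - 1) = real ((p i + N a m - 1) choose (N a m - 1))"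
      by (simp add: binomial_gbinomial)
    also have "\<dots> = fact (p i + N a m - 1) / (fact (N a m - 1) * fact (p i))"
      using N by (subst binomial_fact) auto
    finally show ?thesis using N by (simp add: i n fact_reduce[of "N a m"])
  qed
  have fin: "finite (offdiag_solutions t \<nu> N)"
    and card: "real (card (offdiag_solutions t \<nu> N)) =
      det_on ?I (Fmat t \<nu> N) * (\<Prod>i\<in>?I. fact (p i + n i - 1) / fact (p i))"
    using card_off_diagonal_sols pos by (auto simp: det sols)
  have "(\<Prod>i\<in>?I. fact (p i + n i - 1) / fact (p i)) = (\<Prod>i\<in>?I. fact (n i)) * (\<Prod>(a, m) \<in> ?I.
      1 / real (N a m) * ((Pvac t \<nu> N a m + real (N a m) - 1) gchoose (N a m - 1)))"
    using prod.cong[OF refl binom] by (simp only: prod.distrib)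
  moreover have "(\<Prod>i\<in>?I. fact (n i) :: real) \<noteq> 0" using finite_Hprime[OF assms(3)] by simp
  moreover have "(\<Prod>(a, m) \<in> ?I. fact (N a m)) = (\<Prod>i\<in>?I. fact (n i) :: real)"
    by (simp add: case_prod_unfold flip: n)
  \<comment> \<open>For N = 0 the determinant and the product over the empty set are both 1, in
    agreement with the separate clause of \<open>Rnum\<close>.\<close>
  moreover have "Rnum t \<nu> N = det_on ?I (Fmat t \<nu> N) * (\<Prod>(a, m) \<in> ?I. (1 / real (N a m)) *
        ((Pvac t \<nu> N a m + real (N a m) - 1) gchoose (N a m - 1)))"
    by (simp add: Rnum_def det_on_def)
  moreover have "x * (f * g) / f = x * g" if "f \<noteq> 0" for x f g :: real
    using that by simp
  ultimately show ?thesis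
    using fin card by (simp only: simp_thms)
qed

end
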